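(* Let $\mathcal M=\langle\mathcal S,\mathcal A,P,c,\gamma\rangle$ and $\hat{\mathcal M}=\langle\mathcal S,\mathcal A,\hat P,\hat c,\gamma\rangle$ be two MDPs with costs bounded below, let $w:\mathcal S\to[1,\infty)$ be a weight function and $\kappa>0$ with $\gamma\kappa<1$. Assume that both models are DP-solvable with respect to $w$, that $\mathcal G(V^\star)\cap\Pi_S(\kappa,w)\neq\emptyset$ and that $\hat{\mathcal G}(\hat V^\star)\cap\Pi_S(\kappa,w)\cap\hat\Pi_S(\kappa,w)\neq\emptyset$. Let $\pi^\star\in\mathcal G(V^\star)\cap\Pi_S(\kappa,w)$ and $\hat\pi^\star\in\hat{\mathcal G}(\hat V^\star)\cap\Pi_S(\kappa,w)\cap\hat\Pi_S(\kappa,w)$. Then: 1. $$\|V^{\hat\pi^\star}-V^\star\|_w\le\frac{1}{1-\gamma\kappa}\bigl[\mathcal D^{\hat\pi^\star}\hat V^\star+\mathcal D^{\pi^\star,\hat\pi^\star}\hat V^\star\bigr]$$ and $$\|V^{\hat\pi^\star}-V^\star\|_w\le\frac{1}{1-\gamma\kappa}\mathcal D^{\hat\pi^\star}V^\star+\frac{1+\gamma\kappa}{(1-\gamma\kappa)^2}\mathcal D^{\pi^\star,\hat\pi^\star}V^\star .$$ 2. If in addition $\mathcal G(\hat V^\star)\cap\Pi_S(\kappa,w)\neq\emptyset$, then $$\|V^{\hat\pi^\star}-V^\star\|_w\le\frac{1}{1-\gamma\kappa}\bigl[\mathcal D^{\hat\pi^\star}\hat V^\star+\mathcal D^{\star}\hat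 V^\star\bigr].$$ 3. If (in addition to the hypotheses preceding item 1) $\hat{\mathcal G}(V^\star)\cap\hat\Pi_S(\kappa,w)\neq\emptyset$, then $$\|V^{\hat\pi^\star}-V^\star\|_w\le\frac{1}{1-\gamma\kappa}\mathcal D^{\hat\pi^\star}V^\star+\frac{1+\gamma\kappa}{(1-\gamma\kappa)^2}\mathcal D^{\star}V^\star .$$
   Context: MDPs. An MDP $\mathcal M=\langle\mathcal S,\mathcal A,P,c,\gamma\rangle$ consists of Borel spaces $\mathcal S$ (states) and $\mathcal A$ (actions), a stochastic kernel $P(\cdot\mid s,a)$ from $\mathcal S\times\mathcal A$ to $\mathcal S$, a measurable per-step cost $c:\mathcal S\times\mathcal A\to\mathbb R$ bounded from below, and a discount factor $\gamma\in(0,1)$. The second MDP $\hat{\mathcal M}$ has the same $\mathcal S,\mathcal A,\gamma$ but possibly different kernel $\hat P$ and cost $\hat c$; $c_{\min}\in\mathbb R$ is a constant with $c\ge c_{\min}$ and $\hat c\ge c_{\min}$. A policy is a stochastic kernel $\pi:\mathcal S\to\Delta(\mathcal A)$ (time-homogeneous, possibly randomized); $\Pi$ is the set of all policies. Put $c_\pi(s)=\int_{\mathcal A}c(s,a)\pi(da|s)$, $P_\pi(ds'|s)=\int_{\mathcal A}\pi(da|s)P(ds'|s,a)$. The value function of $\pi$ is $V^\pi(s)=\mathbb E^\pi\bigl[\sum_{t\ge1}\gamma^{t-1}c(S_t,A_t)\mid S_1=s\bigr]$. Function space and operators. $\mathcal V$ is the set of measurable functions $\mathcal S\to[\frac{c_{\min}}{1-\gamma},\infty)\cup\{+\infty\}$.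 For $w:\mathcal S\to[1,\infty)$, $\|v\|_w=\sup_{s}|v(s)|/w(s)$ (also used for differences of functions) and $\mathcal V_w=\{v\in\mathcal V:\|v\|_w<\infty\}$. Bellman operators: $[\mathcal B^\pi v](s)=c_\pi(s)+\gamma\int v(s')P_\pi(ds'|s)$ and $[\mathcal B^\star v](s)=\inf_{a\in\mathcal A}\{c(s,a)+\gamma\int v(s')P(ds'|s,a)\}$. $\mathcal G(v)=\{\pi\in\Pi:\mathcal B^\pi v=\mathcal B^\star v\}$ is the set of one-step greedy policies with respect to $v$. DP-solvability. $\mathcal M$ is DP-solvable with respect to $w$ if (i) $\mathcal B^\star v\in\mathcal V_w$ for all $v\in\mathcal V_w$; (ii) there is $V^\star\in\mathcal V_w$ with $V^\star(s)\le V^\pi(s)$ for all $s$ and all $\pi\in\Pi$, with equality at all states for at least one $\pi\in\Pi$; (iii) $V^\star=\mathcal B^\star V^\star$. This $V^\star$ is the optimal value function. Stability. For $\kappa>0$ with $\gamma\kappa<1$, a policy $\pi$ is $(\kappa,w)$ stable for $\mathcal M$ if $\|c_\pi\|_w<\infty$ and $\int w(s')P_\pi(ds'|s)\le\kappa w(s)$ for all $s$. $\Pi_S(\kappa,w)$ is the set of $(\kappa,w)$-stable policies for $\mathcal M$. Hats denote the corresponding objects for $\hat{\mathcal M}$: $\hat V^\pi,\hat V^\star,\hat{\mathcal B}^\pi,\hat{\mathcal B}^\star,\hat{\mathcal G}(v),\hat\Pi_S(\kappa,w)$. In particular $V^{\hat\pi^\star}$ is the value function of $\hat\pi^\star$ in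 $\mathcal M$. Bellman mismatch functionals. For $v\in\mathcal V_w$: $\mathcal D^{\pi,\hat\pi}v=\|\mathcal B^\pi v-\hat{\mathcal B}^{\hat\pi}v\|_w$ for $\pi\in\Pi_S(\kappa,w)$, $\hat\pi\in\hat\Pi_S(\kappa,w)$; $\mathcal D^\pi v=\mathcal D^{\pi,\pi}v$ for $\pi\in\Pi_S(\kappa,w)\cap\hat\Pi_S(\kappa,w)$; $\mathcal D^\star v=\|\mathcal B^\star v-\hat{\mathcal B}^\star v\|_w$. *)

theory Defs
  imports "HOL-Probability.Probability"
begin

text \<open>
  Borel spaces are Borel subsets of Polish spaces with the trace sigma-algebra.  States, actions and
  state-action pairs therefore live on carrier sets, and every function below is only meaningful on
  its carrier: pointwise statements are always relativised to it.
\<close>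

record ('s, 'a) mdp =
  state_set :: "'s set"
  action_set :: "'a set"
  kernel :: "'s \<times> 'a \<Rightarrow> 's measure"
  cost :: "'s \<times> 'a \<Rightarrow> real"
  discount :: real

definition state_space :: "('s::polish_space, 'a) mdp \<Rightarrow> 's measure" where
  "state_space M = restrict_space borel (state_set M)"

definition action_space :: "('s, 'a::polish_space) mdp \<Rightarrow> 'a measure" where
  "action_space M = restrict_space borel (action_set M)"

definition pair_space :: "('s::polish_space, 'a::polish_space) mdp \<Rightarrow> ('s \<times> 'a) measure" where
  "pair_space M = state_space M \<Otimes>\<^sub>M action_space M"

definition is_mdp :: "('s::polish_space, 'a::polish_space) mdp \<Rightarrow> bool" where
  "is_mdp M \<longleftrightarrow>
     state_set M \<in> sets borel \<and>
     action_set M \<in> sets borel \<and>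
     kernel M \<in> pair_space M \<rightarrow>\<^sub>M prob_algebra (state_space M) \<and>
     cost M \<in> borel_measurable (pair_space M) \<and>
     (\<exists>b. \<forall>s\<in>state_set M. \<forall>a\<in>action_set M. b \<le> cost M (s, a)) \<and>
     0 < discount M \<and> discount M < 1"

definition policies :: "('s::polish_space, 'a::polish_space) mdp \<Rightarrow> ('s \<Rightarrow> 'a measure) set" where
  "policies M = state_space M \<rightarrow>\<^sub>M prob_algebra (action_space M)"

text \<open>
  Lebesgue integral of an extended-real function as positive part minus negative part.  It is used
  only for functions bounded below on a probability space, where the negative part is finite and the
  integral may be \<open>\<infinity>\<close>.  (Recall \<open>e2ennreal x = 0\<close> for \<open>x \<le> 0\<close>.)
\<close>

definition ext_integral :: "'x measure \<Rightarrow> ('x \<Rightarrow> ereal) \<Rightarrow> ereal" where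
  "ext_integral N f =
     enn2ereal (\<integral>\<^sup>+ x. e2ennreal (f x) \<partial>N) - enn2ereal (\<integral>\<^sup>+ x. e2ennreal (- f x) \<partial>N)"

definition policy_cost ::
    "('s::polish_space, 'a::polish_space) mdp \<Rightarrow> ('s \<Rightarrow> 'a measure) \<Rightarrow> 's \<Rightarrow> ereal" where
  "policy_cost M \<pi> s = ext_integral (\<pi> s) (\<lambda>a. ereal (cost M (s, a)))"

definition policy_kernel ::
    "('s::polish_space, 'a::polish_space) mdp \<Rightarrow> ('s \<Rightarrow> 'a measure) \<Rightarrow> 's \<Rightarrow> 's measure" where
  "policy_kernel M \<pi> s = bind (\<pi> s) (\<lambda>a. kernel M (s, a))"

text \<open>
  The law of the process of state-action pairs under a policy, started in \<open>s\<close>, on the space of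
  infinite sequences: the projective limit given by the Ionescu-Tulcea theorem, for the conditional
  law \<open>next_pair\<close> of the \<open>n\<close>-th pair given the earlier pairs \<open>\<omega> 0, \<dots>, \<omega> (n - 1)\<close>.
  Time starts at 0, so the pair \<open>(S_{t+1}, A_{t+1})\<close> of the one-based convention is \<open>\<omega> t\<close>.
\<close>

definition attach_action ::
    "('s::polish_space, 'a::polish_space) mdp \<Rightarrow> ('s \<Rightarrow> 'a measure) \<Rightarrow> 's measure \<Rightarrow> ('s \<times> 'a) measure"
  where
  "attach_action M \<pi> \<mu> = bind \<mu> (\<lambda>x. bind (\<pi> x) (\<lambda>a. return (pair_space M) (x, a)))"

definition next_pair ::
    "('s::polish_space, 'a::polish_space) mdp \<Rightarrow> ('s \<Rightarrow> 'a measure) \<Rightarrow> 's \<Rightarrow> nat \<Rightarrow>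
       (nat \<Rightarrow> 's \<times> 'a) \<Rightarrow> ('s \<times> 'a) measure" where
  "next_pair M \<pi> s n \<omega> =
     attach_action M \<pi> (if n = 0 then return (state_space M) s else kernel M (\<omega> (n - 1)))"

definition trajectory_law ::
    "('s::polish_space, 'a::polish_space) mdp \<Rightarrow> ('s \<Rightarrow> 'a measure) \<Rightarrow> 's \<Rightarrow>
       (nat \<Rightarrow> 's \<times> 'a) measure" where
  "trajectory_law M \<pi> s =
     projective_family.lim UNIV
       (Ionescu_Tulcea.CI (next_pair M \<pi> s) (\<lambda>_. pair_space M)) (\<lambda>_. pair_space M)"

lemma Ionescu_Tulcea_next_pair:
  assumes "is_mdp M" "\<pi> \<in> policies M" "s \<in> state_set M"
  shows "Ionescu_Tulcea (next_pair M \<pi> s) (\<lambda>_. pair_space M)"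
proof -
  have kernel: "kernel M \<in> pair_space M \<rightarrow>\<^sub>M prob_algebra (state_space M)"
    and [measurable]: "\<pi> \<in> state_space M \<rightarrow>\<^sub>M prob_algebra (action_space M)"
    using assms by (auto simp: is_mdp_def policies_def)
  have s: "s \<in> space (state_space M)" using assms by (simp add: state_space_def space_restrict_space)
  have attach: "attach_action M \<pi> \<in> prob_algebra (state_space M) \<rightarrow>\<^sub>M prob_algebra (pair_space M)"
    unfolding attach_action_def pair_space_def by measurable
  have kernel_at: "next_pair M \<pi> s n \<in> PiM {0..<n} (\<lambda>_. pair_space M) \<rightarrow>\<^sub>M prob_algebra (pair_space M)" for n
  proof (cases n)
    case 0
    then have "next_pair M \<pi> s n = (\<lambda>_. attach_action M \<pi> (return (state_space M) s))"
      by (simp add: next_pair_def fun_eq_iff)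
    moreover have "attach_action M \<pi> (return (state_space M) s) \<in> space (prob_algebra (pair_space M))"
      using s by (intro measurable_space[OF attach] measurable_space[OF measurable_return_prob_space])
    ultimately show ?thesis by (simp add: measurable_const)
  next
    case (Suc k)
    have "(\<lambda>\<omega>. \<omega> k) \<in> PiM {0..<n} (\<lambda>_. pair_space M) \<rightarrow>\<^sub>M pair_space M"
      by (rule measurable_component_singleton) (simp add: Suc)
    from measurable_compose[OF measurable_compose[OF this kernel] attach]
    show ?thesis by (simp add: Suc next_pair_def[abs_def])
  qed
  show ?thesis
  proof (rule Ionescu_Tulcea.intro)
    show "next_pair M \<pi> s n \<in> PiM {0..<n} (\<lambda>_. pair_space M) \<rightarrow>\<^sub>M subprob_algebra (pair_space M)" for n
      by (rule measurable_prob_algebraD[OF kernel_at])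
    show "prob_space (next_pair M \<pi> s n \<omega>)" if "\<omega> \<in> space (PiM {0..<n} (\<lambda>_. pair_space M))" for n \<omega>
      using measurable_space[OF kernel_at that] by (simp add: space_prob_algebra)
  qed
qed

text \<open>
  The partial sums of the discounted cost are bounded below by a convergent series, so the series
  converges in the extended reals along every trajectory.
\<close>

definition policy_value ::
    "('s::polish_space, 'a::polish_space) mdp \<Rightarrow> ('s \<Rightarrow> 'a measure) \<Rightarrow> 's \<Rightarrow> ereal" where
  "policy_value M \<pi> s =
     ext_integral (trajectory_law M \<pi> s) (\<lambda>\<omega>. \<Sum>t. ereal (discount M ^ t * cost M (\<omega> t)))"

definition wnorm :: "'s set \<Rightarrow> ('s \<Rightarrow> real) \<Rightarrow> ('s \<Rightarrow> ereal) \<Rightarrow> ennreal" where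
  "wnorm X w v = (SUP s\<in>X. e2ennreal (\<bar>v s\<bar> / ereal (w s)))"

definition value_functions ::
    "('s::polish_space, 'a::polish_space) mdp \<Rightarrow> real \<Rightarrow> ('s \<Rightarrow> ereal) set" where
  "value_functions M c_min =
     {v \<in> borel_measurable (state_space M).
        \<forall>s\<in>state_set M. ereal (c_min / (1 - discount M)) \<le> v s}"

definition weighted_value_functions ::
    "('s::polish_space, 'a::polish_space) mdp \<Rightarrow> real \<Rightarrow> ('s \<Rightarrow> real) \<Rightarrow> ('s \<Rightarrow> ereal) set" where
  "weighted_value_functions M c_min w =
     {v \<in> value_functions M c_min. wnorm (state_set M) w v < \<infinity>}"

definition bellman ::
    "('s::polish_space, 'a::polish_space) mdp \<Rightarrow> ('s \<Rightarrow> 'a measure) \<Rightarrow> ('s \<Rightarrow> ereal) \<Rightarrow> 's \<Rightarrow> ereal"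
  where
  "bellman M \<pi> v s =
     policy_cost M \<pi> s + ereal (discount M) * ext_integral (policy_kernel M \<pi> s) v"

definition bellman_opt ::
    "('s::polish_space, 'a::polish_space) mdp \<Rightarrow> ('s \<Rightarrow> ereal) \<Rightarrow> 's \<Rightarrow> ereal" where
  "bellman_opt M v s =
     (INF a\<in>action_set M.
        ereal (cost M (s, a)) + ereal (discount M) * ext_integral (kernel M (s, a)) v)"

definition greedy ::
    "('s::polish_space, 'a::polish_space) mdp \<Rightarrow> ('s \<Rightarrow> ereal) \<Rightarrow> ('s \<Rightarrow> 'a measure) set" where
  "greedy M v = {\<pi> \<in> policies M. \<forall>s\<in>state_set M. bellman M \<pi> v s = bellman_opt M v s}"

text \<open>
  Conditions (ii) and (iii) of DP-solvability; they determine \<open>V\<close> uniquely on \<open>state_set M\<close>.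
\<close>

definition is_optimal_value ::
    "('s::polish_space, 'a::polish_space) mdp \<Rightarrow> real \<Rightarrow> ('s \<Rightarrow> real) \<Rightarrow> ('s \<Rightarrow> ereal) \<Rightarrow> bool"
  where
  "is_optimal_value M c_min w V \<longleftrightarrow>
     V \<in> weighted_value_functions M c_min w \<and>
     (\<forall>\<pi>\<in>policies M. \<forall>s\<in>state_set M. V s \<le> policy_value M \<pi> s) \<and>
     (\<exists>\<pi>\<in>policies M. \<forall>s\<in>state_set M. V s = policy_value M \<pi> s) \<and>
     (\<forall>s\<in>state_set M. V s = bellman_opt M V s)"

definition DP_solvable ::
    "('s::polish_space, 'a::polish_space) mdp \<Rightarrow> real \<Rightarrow> ('s \<Rightarrow> real) \<Rightarrow> bool" where
  "DP_solvable M c_min w \<longleftrightarrow>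
     (\<forall>v\<in>weighted_value_functions M c_min w. bellman_opt M v \<in> weighted_value_functions M c_min w) \<and>
     (\<exists>V. is_optimal_value M c_min w V)"

definition stable_policies ::
    "('s::polish_space, 'a::polish_space) mdp \<Rightarrow> real \<Rightarrow> ('s \<Rightarrow> real) \<Rightarrow> ('s \<Rightarrow> 'a measure) set"
  where
  "stable_policies M \<kappa> w =
     {\<pi> \<in> policies M.
        wnorm (state_set M) w (policy_cost M \<pi>) < \<infinity> \<and>
        (\<forall>s\<in>state_set M.
           ext_integral (policy_kernel M \<pi> s) (\<lambda>s'. ereal (w s')) \<le> ereal (\<kappa> * w s))}"

definition mismatch ::
    "('s::polish_space, 'a::polish_space) mdp \<Rightarrow> ('s, 'a) mdp \<Rightarrow> ('s \<Rightarrow> real) \<Rightarrow>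
       ('s \<Rightarrow> 'a measure) \<Rightarrow> ('s \<Rightarrow> 'a measure) \<Rightarrow> ('s \<Rightarrow> ereal) \<Rightarrow> ennreal" where
  "mismatch M M' w \<pi> \<pi>' v = wnorm (state_set M) w (\<lambda>s. bellman M \<pi> v s - bellman M' \<pi>' v s)"

definition mismatch_opt ::
    "('s::polish_space, 'a::polish_space) mdp \<Rightarrow> ('s, 'a) mdp \<Rightarrow> ('s \<Rightarrow> real) \<Rightarrow>
       ('s \<Rightarrow> ereal) \<Rightarrow> ennreal" where
  "mismatch_opt M M' w v = wnorm (state_set M) w (\<lambda>s. bellman_opt M v s - bellman_opt M' v s)"

end

theory Submission
  imports Defs
begin

text \<open>
  Everything rests on one identity.  Write \<open>\<gamma>\<close> for the discount factor, \<open>\<mu> n\<close> for the law of the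
  state at time \<open>n\<close> under a stable policy \<open>\<pi>\<close> started in \<open>s\<close>, and \<open>B\<close> for the Bellman operator of
  \<open>\<pi>\<close>.  For every measurable \<open>u\<close> with \<open>\<bar>u\<bar> \<le> C * w\<close>, the value of \<open>\<pi>\<close> at \<open>s\<close> exceeds \<open>u s\<close> by
  the sum over \<open>n\<close> of \<open>\<gamma> ^ n * (\<integral>x. B u x - u x \<partial>\<mu> n)\<close> (lemma \<open>performance_difference\<close>), because
  the contributions of \<open>u\<close> telescope.  Stability gives \<open>\<integral>x. w x \<partial>\<mu> n \<le> \<kappa> ^ n * w s\<close>, so a residual
  bound \<open>\<bar>B u - u\<bar> \<le> K * w\<close> yields a distance of at most \<open>K * w s / (1 - \<gamma> * \<kappa>)\<close>, and this also
  holds for upper and lower bounds separately.  To obtain the identity for the value defined on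
  trajectories, the coordinate marginals of the Ionescu-Tulcea limit are computed as a Markov chain
  and expectation is exchanged with the discounted series.

  Four consequences combine to the theorem.  Write \<open>u\<close> and \<open>u'\<close> for the real versions of \<open>V\<close>
  and \<open>V'\<close>, and \<open>q = \<gamma> * \<kappa>\<close>.

  \<^item> \<open>u\<close> is a fixed point of the Bellman operator of \<open>\<pi>\<close>, hence the value of \<open>\<pi>\<close>.

  \<^item> \<open>u'\<close> is a fixed point of the Bellman operator of \<open>\<pi>'\<close> in the second model.  Hence its residuals
    in the first model, under \<open>\<pi>'\<close> and under \<open>\<pi>\<close>, are exactly the two mismatches of the first bound,
    which follows by the triangle inequality through \<open>u'\<close>.

  \<^item> The residual of \<open>u\<close> under \<open>\<pi>'\<close> in the first model is at most the mismatch for \<open>\<pi>'\<close> plus its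
    residual under \<open>\<pi>'\<close> in the second model.  The latter is the mismatch between \<open>\<pi>\<close> and \<open>\<pi>'\<close>, which
    gives the second bound, or else at most \<open>1 + q\<close> times the distance of \<open>u\<close> and \<open>u'\<close>.

  \<^item> The distance of \<open>u\<close> and \<open>u'\<close> is at most the optimal mismatch divided by \<open>1 - q\<close>, when stable
    greedy policies exist for both functions in one of the models (lemma \<open>optimal_value_dist\<close>).  With
    the first model this gives the third bound, with the second model the fourth.
\<close>

section \<open>Integration\<close>

lemma ext_integral_cong_AE:
  assumes "AE x in N. f x = g x"
  shows "ext_integral N f = ext_integral N g"
proof -
  have "(\<integral>\<^sup>+ x. e2ennreal (f x) \<partial>N) = (\<integral>\<^sup>+ x. e2ennreal (g x) \<partial>N)"
    "(\<integral>\<^sup>+ x. e2ennreal (- f x) \<partial>N) = (\<integral>\<^sup>+ x. e2ennreal (- g x) \<partial>N)"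
    using assms by (auto intro!: nn_integral_cong_AE)
  then show ?thesis by (simp add: ext_integral_def)
qed

lemma ext_integral_eq_integral:
  fixes f :: "'x \<Rightarrow> real"
  assumes "integrable N f"
  shows "ext_integral N (\<lambda>x. ereal (f x)) = ereal (\<integral>x. f x \<partial>N)"
proof -
  have "(\<integral>\<^sup>+ x. ennreal (f x) \<partial>N) \<noteq> \<infinity>" "(\<integral>\<^sup>+ x. ennreal (- f x) \<partial>N) \<noteq> \<infinity>"
    using assms by (auto simp: real_integrable_def)
  then show ?thesis
    by (cases rule: ennreal2_cases[of "\<integral>\<^sup>+ x. ennreal (f x) \<partial>N" "\<integral>\<^sup>+ x. ennreal (- f x) \<partial>N"])
       (simp_all add: ext_integral_def real_lebesgue_integral_def[OF assms])
qed

text \<open>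
  For a function that is bounded below, the negative part has finite integral, so only the positive
  part can make \<open>ext_integral\<close> infinite.  This is how the finiteness conditions in the definition
  of a stable policy become integrability.
\<close>

lemma integrable_if_ext_integral_finite:
  fixes f :: "'x \<Rightarrow> real"
  assumes "finite_measure N" and f: "f \<in> borel_measurable N"
    and b: "\<And>x. x \<in> space N \<Longrightarrow> b \<le> f x"
    and fin: "ext_integral N (\<lambda>x. ereal (f x)) < \<infinity>"
  shows "integrable N f"
proof -
  interpret finite_measure N by fact
  have "(\<integral>\<^sup>+ x. ennreal (- f x) \<partial>N) \<le> (\<integral>\<^sup>+ x. ennreal \<bar>b\<bar> \<partial>N)"
    using b by (intro nn_integral_mono ennreal_leI) fastforce
  also have "\<dots> < \<infinity>" by (simp add: ennreal_mult_eq_top_iff less_top[symmetric])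
  finally have neg: "(\<integral>\<^sup>+ x. ennreal (- f x) \<partial>N) < \<infinity>" .
  have "(\<integral>\<^sup>+ x. ennreal (f x) \<partial>N) \<noteq> \<infinity>"
  proof
    assume "(\<integral>\<^sup>+ x. ennreal (f x) \<partial>N) = \<infinity>"
    with neg fin show False
      by (cases "\<integral>\<^sup>+ x. ennreal (- f x) \<partial>N") (auto simp: ext_integral_def)
  qed
  with neg f show ?thesis by (simp add: real_integrable_def)
qed

text \<open>
  Fubini for a kernel composition, for integrands that are merely integrable: weight functions and
  costs are unbounded, so a boundedness assumption on \<open>f\<close> would be too strong.  Integrability
  passes to almost every fibre only, since \<open>\<integral>\<^sup>+ y. \<bar>f y\<bar> \<partial>K x\<close> may be infinite on a null set.
\<close>

lemma
  fixes f :: "'y \<Rightarrow> real"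
  assumes K: "K \<in> N \<rightarrow>\<^sub>M subprob_algebra B" and N: "space N \<noteq> {}"
    and int: "integrable (N \<bind> K) f"
  shows AE_integrable_kernel: "AE x in N. integrable (K x) f"
    and integrable_integral_kernel: "integrable N (\<lambda>x. \<integral>y. f y \<partial>K x)"
    and integral_bind_integrable: "(\<integral>y. f y \<partial>(N \<bind> K)) = (\<integral>x. \<integral>y. f y \<partial>K x \<partial>N)"
proof -
  have sB: "sets (N \<bind> K) = sets B" by (rule sets_bind_measurable[OF K N])
  have f: "f \<in> borel_measurable B"
    using borel_measurable_integrable[OF int] by (simp cong: measurable_cong_sets add: sB)
  \<comment> \<open>The positive part and the negative part of f are both handled by the same nonnegative statement.\<close>
  define p where "p g x = (\<integral>\<^sup>+ y. ennreal (g y) \<partial>K x)" for g :: "'y \<Rightarrow> real" and x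
  have part: "(\<integral>\<^sup>+ x. p g x \<partial>N) = (\<integral>\<^sup>+ y. ennreal (g y) \<partial>(N \<bind> K))
      \<and> p g \<in> borel_measurable N \<and> (AE x in N. p g x \<noteq> \<infinity>)
      \<and> integrable N (\<lambda>x. enn2real (p g x))
      \<and> (\<integral>x. enn2real (p g x) \<partial>N) = enn2real (\<integral>\<^sup>+ y. ennreal (g y) \<partial>(N \<bind> K))"
    if g: "g \<in> borel_measurable B" and fin: "(\<integral>\<^sup>+ y. ennreal (g y) \<partial>(N \<bind> K)) \<noteq> \<infinity>" for g
  proof -
    have eq: "(\<integral>\<^sup>+ x. p g x \<partial>N) = (\<integral>\<^sup>+ y. ennreal (g y) \<partial>(N \<bind> K))"
      unfolding p_def using g K by (intro nn_integral_bind[symmetric]) auto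
    have m: "p g \<in> borel_measurable N"
      unfolding p_def
      by (rule measurable_compose[OF K nn_integral_measurable_subprob_algebra]) (use g in measurable)
    have ae: "AE x in N. p g x \<noteq> \<infinity>"
      using m fin eq by (intro nn_integral_PInf_AE) auto
    have e: "(\<integral>\<^sup>+ x. ennreal (enn2real (p g x)) \<partial>N) = (\<integral>\<^sup>+ x. p g x \<partial>N)"
      using ae by (intro nn_integral_cong_AE) (auto simp: less_top)
    have i: "integrable N (\<lambda>x. enn2real (p g x))"
      using m fin e eq by (intro integrableI_bounded) (auto simp: less_top)
    have "(\<integral>x. enn2real (p g x) \<partial>N) = enn2real (\<integral>\<^sup>+ x. ennreal (enn2real (p g x)) \<partial>N)"
      using m by (intro integral_eq_nn_integral) auto
    with e eq m ae i show ?thesis by simp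
  qed
  have P: "(\<integral>\<^sup>+ y. ennreal (f y) \<partial>(N \<bind> K)) \<noteq> \<infinity>" "(\<integral>\<^sup>+ y. ennreal (- f y) \<partial>(N \<bind> K)) \<noteq> \<infinity>"
    using int by (auto simp: real_integrable_def)
  note pos = part[OF f P(1)] and neg = part[OF borel_measurable_uminus[OF f] P(2)]
  have Kf: "f \<in> borel_measurable (K x)" if "x \<in> space N" for x
    using f subprob_measurableD(2)[OF K that] by (simp cong: measurable_cong_sets)
  show ae: "AE x in N. integrable (K x) f"
    using pos neg by (auto simp: real_integrable_def p_def intro: Kf)
  have eq: "AE x in N. enn2real (p f x) - enn2real (p (\<lambda>y. - f y) x) = (\<integral>y. f y \<partial>K x)"
    using ae by eventually_elim (simp add: real_lebesgue_integral_def p_def)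
  have m: "(\<lambda>x. \<integral>y. f y \<partial>K x) \<in> borel_measurable N"
    by (rule measurable_compose[OF K integral_measurable_subprob_algebra[OF f]])
  have d: "integrable N (\<lambda>x. enn2real (p f x) - enn2real (p (\<lambda>y. - f y) x))"
    using pos neg by auto
  show "integrable N (\<lambda>x. \<integral>y. f y \<partial>K x)"
    using integrable_cong_AE[OF borel_measurable_integrable[OF d] m eq] d by simp
  have "(\<integral>x. \<integral>y. f y \<partial>K x \<partial>N) = (\<integral>x. enn2real (p f x) - enn2real (p (\<lambda>y. - f y) x) \<partial>N)"
    using integral_cong_AE[OF borel_measurable_integrable[OF d] m eq] by simp
  also have "\<dots> = (\<integral>y. f y \<partial>(N \<bind> K))"
    using pos neg by (simp add: real_lebesgue_integral_def[OF int])
  finally show "(\<integral>y. f y \<partial>(N \<bind> K)) = (\<integral>x. \<integral>y. f y \<partial>K x \<partial>N)" ..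
qed

text \<open>
  The expected total cost is defined through a series of extended reals along each trajectory.
  Absolute summability in mean makes this series converge absolutely almost surely, so that it is the
  real series there and expectation and summation may be exchanged.
\<close>

lemma
  fixes f :: "nat \<Rightarrow> 'x \<Rightarrow> real"
  assumes int: "\<And>t. integrable N (f t)" and sum: "summable (\<lambda>t. \<integral>x. \<bar>f t x\<bar> \<partial>N)"
  shows ext_integral_suminf: "ext_integral N (\<lambda>x. \<Sum>t. ereal (f t x)) = ereal (\<Sum>t. \<integral>x. f t x \<partial>N)"
    and summable_integral_if_abs: "summable (\<lambda>t. \<integral>x. f t x \<partial>N)"
proof -
  have [measurable]: "f t \<in> borel_measurable N" for t using int by auto
  have "(\<integral>\<^sup>+ x. (\<Sum>t. ennreal \<bar>f t x\<bar>) \<partial>N) = (\<Sum>t. \<integral>\<^sup>+ x. ennreal \<bar>f t x\<bar> \<partial>N)"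
    by (intro nn_integral_suminf) auto
  also have "\<dots> = (\<Sum>t. ennreal (\<integral>x. \<bar>f t x\<bar> \<partial>N))"
    using int by (intro suminf_cong nn_integral_eq_integral) auto
  also have "\<dots> \<noteq> \<infinity>"
    using sum by (simp add: ennreal_suminf_neq_top)
  finally have "AE x in N. (\<Sum>t. ennreal \<bar>f t x\<bar>) \<noteq> \<infinity>"
    by (intro nn_integral_PInf_AE) auto
  then have ae: "AE x in N. summable (\<lambda>t. \<bar>f t x\<bar>)"
    by eventually_elim (auto intro: summable_suminf_not_top)
  have s: "summable (\<lambda>t. \<integral>x. norm (f t x) \<partial>N)" "AE x in N. summable (\<lambda>t. norm (f t x))"
    using sum ae by auto
  have "AE x in N. (\<Sum>t. ereal (f t x)) = ereal (\<Sum>t. f t x)"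
    using ae by eventually_elim (rule suminf_ereal'[OF summable_rabs_cancel])
  then have "ext_integral N (\<lambda>x. \<Sum>t. ereal (f t x)) = ext_integral N (\<lambda>x. ereal (\<Sum>t. f t x))"
    by (rule ext_integral_cong_AE)
  also have "\<dots> = ereal (\<Sum>t. \<integral>x. f t x \<partial>N)"
    using integrable_suminf[OF int s(2,1)] integral_suminf[OF int s(2,1)]
    by (simp add: ext_integral_eq_integral)
  finally show "ext_integral N (\<lambda>x. \<Sum>t. ereal (f t x)) = ereal (\<Sum>t. \<integral>x. f t x \<partial>N)" .
  show "summable (\<lambda>t. \<integral>x. f t x \<partial>N)" by (rule summable_integral[OF int s(2,1)])
qed

section \<open>Coordinates of an Ionescu-Tulcea limit\<close>

context Ionescu_Tulcea
begin

lemma up_to_atLeastLessThan: "up_to {0..<n} = n"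
proof (rule antisym)
  show "up_to {0..<n} \<le> n" by (simp add: up_to_iff)
  show "n \<le> up_to {0..<n}"
    using up_to[of "{0..<n}"] by (cases n) auto
qed

lemma distr_lim_component_C:
  "distr PF.lim (M n) (\<lambda>\<omega>. \<omega> n) = distr (C 0 (Suc n) (\<lambda>_. undefined)) (M n) (\<lambda>\<omega>. \<omega> n)"
proof -
  let ?J = "{0..<Suc n}"
  note [measurable_cong] = sets_C[of "\<lambda>_. undefined" 0 "Suc n", simplified]
  have "distr PF.lim (M n) (\<lambda>\<omega>. \<omega> n) = distr (distr PF.lim (PiM ?J M) (\<lambda>\<omega>. restrict \<omega> ?J)) (M n) (\<lambda>\<omega>. \<omega> n)"
    by (subst distr_distr) (auto simp: comp_def measurable_cong_sets[OF PF.sets_lim refl]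
          intro!: distr_cong measurable_restrict)
  also have "\<dots> = distr (CI ?J) (M n) (\<lambda>\<omega>. \<omega> n)" by (simp add: distr_lim)
  also have "\<dots> = distr (C 0 (Suc n) (\<lambda>_. undefined)) (M n) (\<lambda>\<omega>. \<omega> n)"
    unfolding CI_def up_to_atLeastLessThan
    by (subst distr_distr) (auto simp: comp_def simp del: C.simps intro!: distr_cong measurable_restrict)
  finally show ?thesis .
qed

lemma distr_lim_component:
  "distr PF.lim (M n) (\<lambda>\<omega>. \<omega> n) = C 0 n (\<lambda>_. undefined) \<bind> P n"
proof -
  let ?u = "\<lambda>_::nat. undefined :: 'a"
  have u: "?u \<in> space (PiM {0..<0} M)" by (simp add: space_PiM)
  have ne: "space (C 0 n ?u) \<noteq> {}"
    using prob_space.not_empty[OF prob_space_C[OF u]] .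
  have meas: "eP n \<in> C 0 n ?u \<rightarrow>\<^sub>M subprob_algebra (PiM {0..<Suc n} M)"
    using measurable_eP sets_C[OF u, of n] by (simp cong: measurable_cong_sets)
  have "distr PF.lim (M n) (\<lambda>\<omega>. \<omega> n) = distr (C 0 n ?u \<bind> eP n) (M n) (\<lambda>\<omega>. \<omega> n)"
    by (simp add: distr_lim_component_C)
  also have "\<dots> = C 0 n ?u \<bind> (\<lambda>\<omega>. distr (eP n \<omega>) (M n) (\<lambda>\<omega>. \<omega> n))"
    by (rule distr_bind[OF meas ne]) simp
  also have "\<dots> = C 0 n ?u \<bind> P n"
  proof (rule bind_cong[OF refl])
    fix \<omega> assume "\<omega> \<in> space (C 0 n ?u)"
    then have \<omega>: "\<omega> \<in> space (PiM {0..<n} M)" by (simp add: space_C[OF u])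
    have upd: "fun_upd \<omega> n \<in> P n \<omega> \<rightarrow>\<^sub>M PiM {0..<Suc n} M"
      using \<omega> by (intro measurable_fun_upd[where J="{0..<n}"]) (auto simp: sets_P cong: measurable_cong_sets)
    have "distr (eP n \<omega>) (M n) (\<lambda>\<omega>. \<omega> n) = distr (P n \<omega>) (M n) (\<lambda>x. x)"
      unfolding eP_def by (subst distr_distr[OF _ upd]) (auto simp: comp_def)
    also have "\<dots> = P n \<omega>" by (rule distr_id2) (simp add: sets_P[OF \<omega>])
    finally show "distr (eP n \<omega>) (M n) (\<lambda>\<omega>. \<omega> n) = P n \<omega>" .
  qed
  finally show ?thesis .
qed

lemma distr_lim_component_0: "distr PF.lim (M 0) (\<lambda>\<omega>. \<omega> 0) = P 0 (\<lambda>_. undefined)"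
proof -
  have "distr PF.lim (M 0) (\<lambda>\<omega>. \<omega> 0) = return (PiM {0..<0} M) (\<lambda>_. undefined) \<bind> P 0"
    by (simp add: distr_lim_component)
  also have "\<dots> = P 0 (\<lambda>_. undefined)"
    by (rule bind_return[OF P]) (simp add: space_PiM)
  finally show ?thesis .
qed

text \<open>
  If the next kernel only looks at the last coordinate, the coordinate marginals form a Markov chain.
\<close>

lemma distr_lim_component_Suc:
  assumes Q: "Q \<in> M n \<rightarrow>\<^sub>M subprob_algebra (M (Suc n))"
    and eq: "\<And>\<omega>. P (Suc n) \<omega> = Q (\<omega> n)"
  shows "distr PF.lim (M (Suc n)) (\<lambda>\<omega>. \<omega> (Suc n)) = distr PF.lim (M n) (\<lambda>\<omega>. \<omega> n) \<bind> Q"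
proof -
  let ?C = "C 0 (Suc n) (\<lambda>_. undefined)"
  have u: "(\<lambda>_. undefined) \<in> space (PiM {0..<0} M)" by (simp add: space_PiM)
  have comp: "(\<lambda>\<omega>. \<omega> n) \<in> ?C \<rightarrow>\<^sub>M M n"
    using sets_C[OF u, of "Suc n"] by (simp cong: measurable_cong_sets del: C.simps)
  have "distr PF.lim (M n) (\<lambda>\<omega>. \<omega> n) \<bind> Q = ?C \<bind> (\<lambda>\<omega>. Q (\<omega> n))"
    unfolding distr_lim_component_C
    by (rule bind_distr[OF comp Q prob_space.not_empty[OF prob_space_C[OF u]]])
  also have "\<dots> = distr PF.lim (M (Suc n)) (\<lambda>\<omega>. \<omega> (Suc n))"
    unfolding distr_lim_component eq ..
  finally show ?thesis ..
qed

end

section \<open>Marginals of the trajectory law\<close>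

lemma space_state_space [simp]: "space (state_space M) = state_set M"
  by (simp add: state_space_def space_restrict_space)

text \<open>
  Expected costs are computed by iterating \<open>policy_kernel\<close> instead of working on the trajectory space;
  \<open>distr_trajectory_law\<close> below connects the two.
\<close>

primrec state_law ::
  "('s::polish_space, 'a::polish_space) mdp \<Rightarrow> ('s \<Rightarrow> 'a measure) \<Rightarrow> 's \<Rightarrow> nat \<Rightarrow> 's measure"
where
  "state_law M \<pi> s 0 = return (state_space M) s"
| "state_law M \<pi> s (Suc n) = state_law M \<pi> s n \<bind> policy_kernel M \<pi>"

locale mdp_policy =
  fixes M :: "('s::polish_space, 'a::polish_space) mdp" and \<pi> :: "'s \<Rightarrow> 'a measure"
  assumes is_mdp: "is_mdp M" and policy: "\<pi> \<in> policies M"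
begin

abbreviation S where "S \<equiv> state_space M"

lemma measurable_kernel: "kernel M \<in> S \<Otimes>\<^sub>M action_space M \<rightarrow>\<^sub>M prob_algebra S"
  and measurable_policy: "\<pi> \<in> S \<rightarrow>\<^sub>M prob_algebra (action_space M)"
  and measurable_cost: "cost M \<in> borel_measurable (pair_space M)"
  and discount: "0 < discount M" "discount M < 1"
  using is_mdp policy by (auto simp: is_mdp_def policies_def pair_space_def)

definition pair_kernel :: "'s \<Rightarrow> ('s \<times> 'a) measure" where
  "pair_kernel x = \<pi> x \<bind> (\<lambda>a. return (pair_space M) (x, a))"

lemma measurable_pair_kernel: "pair_kernel \<in> S \<rightarrow>\<^sub>M prob_algebra (pair_space M)"
  unfolding pair_kernel_def[abs_def] pair_space_def
  using measurable_policy by measurable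

lemma attach_action_eq: "attach_action M \<pi> \<mu> = \<mu> \<bind> pair_kernel"
  by (simp add: attach_action_def pair_kernel_def[abs_def])

lemma measurable_attach_action:
  "attach_action M \<pi> \<in> prob_algebra S \<rightarrow>\<^sub>M prob_algebra (pair_space M)"
  unfolding attach_action_eq[abs_def]
  by (rule measurable_bind_prob_space[OF measurable_ident measurable_pair_kernel, simplified])

lemma measurable_policy_kernel: "policy_kernel M \<pi> \<in> S \<rightarrow>\<^sub>M prob_algebra S"
  unfolding policy_kernel_def[abs_def]
  using measurable_policy measurable_kernel by measurable

lemma policy_in_prob_algebra: "x \<in> state_set M \<Longrightarrow> \<pi> x \<in> space (prob_algebra (action_space M))"
  using measurable_space[OF measurable_policy] by simp

lemma
  assumes "x \<in> state_set M"
  shows prob_space_policy: "prob_space (\<pi> x)"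
    and sets_policy: "sets (\<pi> x) = sets (action_space M)"
    and space_policy: "space (\<pi> x) = action_set M"
proof -
  show 1: "prob_space (\<pi> x)" "sets (\<pi> x) = sets (action_space M)"
    using policy_in_prob_algebra[OF assms] by (auto simp: space_prob_algebra)
  show "space (\<pi> x) = action_set M"
    using sets_eq_imp_space_eq[OF 1(2)] by (simp add: action_space_def space_restrict_space)
qed

lemma
  assumes "x \<in> state_set M"
  shows prob_space_policy_kernel: "prob_space (policy_kernel M \<pi> x)"
    and sets_policy_kernel: "sets (policy_kernel M \<pi> x) = sets S"
    and space_policy_kernel: "space (policy_kernel M \<pi> x) = state_set M"
proof -
  show 1: "prob_space (policy_kernel M \<pi> x)" "sets (policy_kernel M \<pi> x) = sets S"
    using measurable_space[OF measurable_policy_kernel] assms by (auto simp: space_prob_algebra)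
  show "space (policy_kernel M \<pi> x) = state_set M"
    using sets_eq_imp_space_eq[OF 1(2)] by simp
qed

lemma measurable_kernel_section:
  assumes x: "x \<in> state_set M"
  shows "(\<lambda>a. kernel M (x, a)) \<in> action_space M \<rightarrow>\<^sub>M prob_algebra S"
proof -
  have "x \<in> space S" using x by simp
  from measurable_compose[OF measurable_Pair1'[OF this] measurable_kernel] show ?thesis .
qed

lemma measurable_Pair_policy: "x \<in> state_set M \<Longrightarrow> Pair x \<in> \<pi> x \<rightarrow>\<^sub>M pair_space M"
  using measurable_Pair1'[of x S "action_space M"]
  by (simp add: pair_space_def sets_policy cong: measurable_cong_sets)

lemma pair_kernel_eq_distr:
  assumes x: "x \<in> state_set M"
  shows "pair_kernel x = distr (\<pi> x) (pair_space M) (Pair x)"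
  unfolding pair_kernel_def
  by (intro bind_return_distr' prob_space.not_empty prob_space_policy measurable_Pair_policy x)

lemma pair_kernel_bind_kernel:
  assumes x: "x \<in> state_set M"
  shows "pair_kernel x \<bind> kernel M = policy_kernel M \<pi> x"
  unfolding pair_kernel_eq_distr[OF x] policy_kernel_def
  by (rule bind_distr[OF measurable_Pair_policy[OF x] measurable_prob_algebraD])
     (use measurable_kernel prob_space.not_empty[OF prob_space_policy[OF x]] in
       \<open>auto simp: pair_space_def\<close>)

context
  fixes s assumes s: "s \<in> state_set M"
begin

lemma state_law_in_prob_algebra: "state_law M \<pi> s n \<in> space (prob_algebra S)"
proof (induction n)
  case 0
  show ?case using s measurable_space[OF measurable_return_prob_space, of s S] by simp
next
  case (Suc n)
  show ?case
    using measurable_space[OF measurable_bind_prob_space[OF measurable_ident measurable_policy_kernel] Suc]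
    by simp
qed

lemma prob_space_state_law: "prob_space (state_law M \<pi> s n)"
  and sets_state_law: "sets (state_law M \<pi> s n) = sets S"
  using state_law_in_prob_algebra[of n] by (auto simp: space_prob_algebra)

lemma space_state_law: "space (state_law M \<pi> s n) = state_set M"
  using sets_eq_imp_space_eq[OF sets_state_law] by simp

lemma measurable_state_law_iff: "f \<in> state_law M \<pi> s n \<rightarrow>\<^sub>M N \<longleftrightarrow> f \<in> S \<rightarrow>\<^sub>M N"
  by (simp add: measurable_cong_sets[OF sets_state_law refl])

lemma policy_kernel_subprob: "policy_kernel M \<pi> \<in> state_law M \<pi> s n \<rightarrow>\<^sub>M subprob_algebra S"
  by (simp add: measurable_state_law_iff measurable_prob_algebraD[OF measurable_policy_kernel])

lemma pair_kernel_subprob: "pair_kernel \<in> state_law M \<pi> s n \<rightarrow>\<^sub>M subprob_algebra (pair_space M)"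
  by (simp add: measurable_state_law_iff measurable_prob_algebraD[OF measurable_pair_kernel])

text \<open>
  Attaching an action and then applying the transition kernel is one step of the state chain; this
  turns the chain of state-action pairs into the chain of states.
\<close>

lemma attach_state_law_bind_kernel:
  "attach_action M \<pi> (state_law M \<pi> s n) \<bind> kernel M = state_law M \<pi> s (Suc n)"
proof -
  have k: "kernel M \<in> pair_space M \<rightarrow>\<^sub>M subprob_algebra S"
    using measurable_prob_algebraD[OF measurable_kernel] by (simp add: pair_space_def)
  show ?thesis
    unfolding attach_action_eq
    by (subst bind_assoc[OF pair_kernel_subprob k])
       (auto intro!: bind_cong pair_kernel_bind_kernel simp: space_state_law)
qed

interpretation IT: Ionescu_Tulcea "next_pair M \<pi> s" "\<lambda>_. pair_space M"
  by (rule Ionescu_Tulcea_next_pair[OF is_mdp policy s])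

lemma sets_trajectory_law: "sets (trajectory_law M \<pi> s) = sets (PiM UNIV (\<lambda>_. pair_space M))"
  by (simp add: trajectory_law_def)

lemma measurable_coordinate: "(\<lambda>\<omega>. \<omega> n) \<in> trajectory_law M \<pi> s \<rightarrow>\<^sub>M pair_space M"
  by (subst measurable_cong_sets[OF sets_trajectory_law refl]) (rule measurable_component_singleton, simp)

text \<open>
  The stage costs depend on one coordinate each, so their expectations are determined by these
  marginals.
\<close>

lemma distr_trajectory_law:
  "distr (trajectory_law M \<pi> s) (pair_space M) (\<lambda>\<omega>. \<omega> n) = attach_action M \<pi> (state_law M \<pi> s n)"
proof (induction n)
  case 0
  show ?case by (simp add: trajectory_law_def IT.distr_lim_component_0 next_pair_def)
next
  case (Suc n)
  let ?Q = "\<lambda>x. attach_action M \<pi> (kernel M x)"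
  have k: "kernel M \<in> pair_space M \<rightarrow>\<^sub>M prob_algebra S"
    using measurable_kernel by (simp add: pair_space_def)
  have Q: "?Q \<in> pair_space M \<rightarrow>\<^sub>M subprob_algebra (pair_space M)"
    by (rule measurable_prob_algebraD[OF measurable_compose[OF k measurable_attach_action]])
  have sets_attach: "sets (attach_action M \<pi> (state_law M \<pi> s n)) = sets (pair_space M)"
    using measurable_space[OF measurable_attach_action state_law_in_prob_algebra]
    by (simp add: space_prob_algebra)
  have "distr (trajectory_law M \<pi> s) (pair_space M) (\<lambda>\<omega>. \<omega> (Suc n))
      = distr (trajectory_law M \<pi> s) (pair_space M) (\<lambda>\<omega>. \<omega> n) \<bind> ?Q"
    unfolding trajectory_law_def
    by (rule IT.distr_lim_component_Suc[OF Q]) (simp add: next_pair_def)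
  also have "\<dots> = attach_action M \<pi> (state_law M \<pi> s n) \<bind> (\<lambda>x. kernel M x \<bind> pair_kernel)"
    by (simp add: Suc attach_action_eq)
  also have "\<dots> = (attach_action M \<pi> (state_law M \<pi> s n) \<bind> kernel M) \<bind> pair_kernel"
    using measurable_prob_algebraD[OF k] sets_attach
    by (intro bind_assoc[symmetric, where N=S and R="pair_space M"]
          measurable_prob_algebraD[OF measurable_pair_kernel])
       (simp cong: measurable_cong_sets)
  also have "\<dots> = attach_action M \<pi> (state_law M \<pi> s (Suc n))"
    by (simp only: attach_state_law_bind_kernel attach_action_eq[of "state_law M \<pi> s (Suc n)"])
  finally show ?case .
qed

end

end

section \<open>The weighted supremum norm\<close>

lemma wnorm_le_iff:
  assumes w: "\<And>s. s \<in> X \<Longrightarrow> 1 \<le> w s" and K: "0 \<le> K"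
  shows "wnorm X w (\<lambda>s. ereal (f s)) \<le> ennreal K \<longleftrightarrow> (\<forall>s\<in>X. \<bar>f s\<bar> \<le> K * w s)"
proof -
  have "e2ennreal (\<bar>ereal (f s)\<bar> / ereal (w s)) \<le> ennreal K \<longleftrightarrow> \<bar>f s\<bar> \<le> K * w s" if "s \<in> X" for s
    using w[OF that] K by (auto simp: ennreal_le_iff field_simps)
  then show ?thesis by (simp add: wnorm_def SUP_le_iff)
qed

lemma wnorm_cong: "(\<And>s. s \<in> X \<Longrightarrow> f s = g s) \<Longrightarrow> wnorm X w f = wnorm X w g"
  by (simp add: wnorm_def)

text \<open>
  The real-valued counterpart of \<open>weighted_value_functions\<close>, without the lower bound, so that it is
  a vector space.
\<close>

definition wbounded :: "'s measure \<Rightarrow> ('s \<Rightarrow> real) \<Rightarrow> ('s \<Rightarrow> real) \<Rightarrow> bool" where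
  "wbounded N w u \<longleftrightarrow> u \<in> borel_measurable N \<and> (\<exists>C\<ge>0. \<forall>x\<in>space N. \<bar>u x\<bar> \<le> C * w x)"

lemma wbounded_add:
  assumes u: "wbounded N w u" and v: "wbounded N w v"
  shows "wbounded N w (\<lambda>x. u x + v x)"
proof -
  obtain C D where C: "0 \<le> C" "\<And>x. x \<in> space N \<Longrightarrow> \<bar>u x\<bar> \<le> C * w x"
    and D: "0 \<le> D" "\<And>x. x \<in> space N \<Longrightarrow> \<bar>v x\<bar> \<le> D * w x"
    using u v by (auto simp: wbounded_def)
  have "\<bar>u x + v x\<bar> \<le> (C + D) * w x" if "x \<in> space N" for x
    using abs_triangle_ineq[of "u x" "v x"] C(2)[OF that] D(2)[OF that] by (simp add: algebra_simps)
  then show ?thesis using u v C(1) D(1) by (auto simp: wbounded_def intro!: exI[of _ "C + D"])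
qed

lemma wbounded_cmult:
  assumes u: "wbounded N w u"
  shows "wbounded N w (\<lambda>x. r * u x)"
proof -
  obtain C where C: "0 \<le> C" "\<And>x. x \<in> space N \<Longrightarrow> \<bar>u x\<bar> \<le> C * w x"
    using u by (auto simp: wbounded_def)
  have "\<bar>r * u x\<bar> \<le> (\<bar>r\<bar> * C) * w x" if "x \<in> space N" for x
    using mult_left_mono[OF C(2)[OF that], of "\<bar>r\<bar>"] by (simp add: abs_mult mult.assoc)
  then show ?thesis using u C(1) by (auto simp: wbounded_def intro!: exI[of _ "\<bar>r\<bar> * C"])
qed

lemma wbounded_diff: "wbounded N w u \<Longrightarrow> wbounded N w v \<Longrightarrow> wbounded N w (\<lambda>x. u x - v x)"
  using wbounded_add[of N w u "\<lambda>x. -1 * v x"] wbounded_cmult[of N w v "-1"] by simp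

text \<open>
  The supremum norm of a weighted-bounded function is a finite number and is itself a pointwise bound,
  which lets inequalities between norms be proved state by state.
\<close>

lemma wbounded_wnorm:
  assumes f: "wbounded N w f" and w: "\<And>x. x \<in> space N \<Longrightarrow> 1 \<le> w x"
  obtains K where "0 \<le> K" "wnorm (space N) w (\<lambda>x. ereal (f x)) = ennreal K"
    "\<And>x. x \<in> space N \<Longrightarrow> \<bar>f x\<bar> \<le> K * w x"
proof -
  obtain C where C: "0 \<le> C" "\<forall>x\<in>space N. \<bar>f x\<bar> \<le> C * w x" using f by (auto simp: wbounded_def)
  have "wnorm (space N) w (\<lambda>x. ereal (f x)) \<le> ennreal C"
    using C by (subst wnorm_le_iff) (auto intro: w)
  then obtain K where K: "0 \<le> K" "wnorm (space N) w (\<lambda>x. ereal (f x)) = ennreal K"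
    by (cases "wnorm (space N) w (\<lambda>x. ereal (f x))") (auto simp: top_unique)
  with wnorm_le_iff[where X="space N" and w=w and K=K and f=f] w
  have "\<forall>x\<in>space N. \<bar>f x\<bar> \<le> K * w x" by simp
  with K show ?thesis by (auto intro: that)
qed

section \<open>The Bellman operator of a stable policy\<close>

locale stable_policy = mdp_policy M \<pi>
  for M :: "('s::polish_space, 'a::polish_space) mdp" and \<pi> +
  fixes w :: "'s \<Rightarrow> real" and \<kappa> :: real
  assumes w_measurable [measurable]: "w \<in> borel_measurable (state_space M)"
    and w_ge_1: "\<And>x. x \<in> state_set M \<Longrightarrow> 1 \<le> w x"
    and \<kappa>_pos: "0 < \<kappa>" and contraction: "discount M * \<kappa> < 1"
    and stable: "\<pi> \<in> stable_policies M \<kappa> w"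
begin

definition mean_cost :: "'s \<Rightarrow> real" where
  "mean_cost x = (\<integral>a. cost M (x, a) \<partial>\<pi> x)"

definition bellman_real :: "('s \<Rightarrow> real) \<Rightarrow> 's \<Rightarrow> real" where
  "bellman_real u x = mean_cost x + discount M * (\<integral>y. u y \<partial>policy_kernel M \<pi> x)"

definition value_real :: "'s \<Rightarrow> real" where
  "value_real s = (\<Sum>n. discount M ^ n * (\<integral>x. mean_cost x \<partial>state_law M \<pi> s n))"

lemma w_pos: "x \<in> state_set M \<Longrightarrow> 0 < w x"
  using w_ge_1[of x] by simp

lemma cost_section_measurable:
  assumes x: "x \<in> state_set M"
  shows "(\<lambda>a. cost M (x, a)) \<in> borel_measurable (\<pi> x)"
  using measurable_compose[OF measurable_Pair_policy[OF x] measurable_cost] .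

lemma cost_bounded_below:
  obtains b where "0 \<le> b" "\<And>x a. x \<in> state_set M \<Longrightarrow> a \<in> action_set M \<Longrightarrow> - b \<le> cost M (x, a)"
proof -
  obtain b where b: "\<And>x a. x \<in> state_set M \<Longrightarrow> a \<in> action_set M \<Longrightarrow> b \<le> cost M (x, a)"
    using is_mdp by (auto simp: is_mdp_def)
  have "- \<bar>b\<bar> \<le> cost M (x, a)" if "x \<in> state_set M" "a \<in> action_set M" for x a
    using b[OF that] by linarith
  then show ?thesis by (intro that[of "\<bar>b\<bar>"]) auto
qed

text \<open>
  Since \<open>policy_cost\<close> is extended-real, finiteness of its norm also says that it is finite at
  every state.
\<close>

lemma policy_cost_finite:
  obtains C where "0 \<le> C" "\<And>x. x \<in> state_set M \<Longrightarrow> \<bar>policy_cost M \<pi> x\<bar> \<le> ereal (C * w x)"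
proof -
  obtain C where C: "0 \<le> C" "wnorm (state_set M) w (policy_cost M \<pi>) = ennreal C"
    using stable by (cases "wnorm (state_set M) w (policy_cost M \<pi>)") (auto simp: stable_policies_def)
  have "\<bar>policy_cost M \<pi> x\<bar> \<le> ereal (C * w x)" if x: "x \<in> state_set M" for x
  proof -
    have "e2ennreal (\<bar>policy_cost M \<pi> x\<bar> / ereal (w x)) \<le> ennreal C"
      unfolding C(2)[symmetric] wnorm_def by (rule SUP_upper[OF x])
    then show ?thesis
      using w_pos[OF x] C(1)
      by (cases "policy_cost M \<pi> x") (auto simp: ennreal_le_iff field_simps top_unique)
  qed
  with C(1) show ?thesis by (rule that)
qed

lemma cost_integrable:
  assumes x: "x \<in> state_set M"
  shows "integrable (\<pi> x) (\<lambda>a. cost M (x, a))"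
proof -
  obtain b where b: "0 \<le> b" "\<And>x a. x \<in> state_set M \<Longrightarrow> a \<in> action_set M \<Longrightarrow> - b \<le> cost M (x, a)"
    by (rule cost_bounded_below) blast
  obtain C where C: "\<And>x. x \<in> state_set M \<Longrightarrow> \<bar>policy_cost M \<pi> x\<bar> \<le> ereal (C * w x)"
    using policy_cost_finite by metis
  have "ext_integral (\<pi> x) (\<lambda>a. ereal (cost M (x, a))) < \<infinity>"
    using C[OF x] by (cases "policy_cost M \<pi> x") (auto simp: policy_cost_def)
  then show ?thesis
    using b(2)[OF x]
    by (intro integrable_if_ext_integral_finite[where b="- b"] cost_section_measurable x
          prob_space.finite_measure prob_space_policy)
       (auto simp: space_policy[OF x])
qed

lemma policy_cost_eq: "x \<in> state_set M \<Longrightarrow> policy_cost M \<pi> x = ereal (mean_cost x)"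
  unfolding policy_cost_def mean_cost_def by (intro ext_integral_eq_integral cost_integrable)

text \<open>
  Stability bounds only the mean cost.  The lower bound on the cost upgrades this to the mean absolute
  cost: if \<open>- b \<le> c\<close> then \<open>\<bar>c\<bar> \<le> c + 2 b\<close>, and the constant \<open>2 b\<close> is absorbed by
  \<open>w \<ge> 1\<close>.
\<close>

lemma abs_cost_bound:
  obtains C where "0 \<le> C" "\<And>x. x \<in> state_set M \<Longrightarrow> (\<integral>a. \<bar>cost M (x, a)\<bar> \<partial>\<pi> x) \<le> C * w x"
proof -
  obtain b where b: "0 \<le> b" "\<And>x a. x \<in> state_set M \<Longrightarrow> a \<in> action_set M \<Longrightarrow> - b \<le> cost M (x, a)"
    by (rule cost_bounded_below) blast
  obtain C where C: "0 \<le> C" "\<And>x. x \<in> state_set M \<Longrightarrow> \<bar>policy_cost M \<pi> x\<bar> \<le> ereal (C * w x)"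
    using policy_cost_finite by metis
  have "(\<integral>a. \<bar>cost M (x, a)\<bar> \<partial>\<pi> x) \<le> (C + 2 * b) * w x" if x: "x \<in> state_set M" for x
  proof -
    interpret prob_space "\<pi> x" by (rule prob_space_policy[OF x])
    have i: "integrable (\<pi> x) (\<lambda>a. cost M (x, a))" by (rule cost_integrable[OF x])
    have "(\<integral>a. \<bar>cost M (x, a)\<bar> \<partial>\<pi> x) \<le> (\<integral>a. cost M (x, a) + 2 * b \<partial>\<pi> x)"
    proof (rule integral_mono)
      fix a assume "a \<in> space (\<pi> x)"
      then have "- b \<le> cost M (x, a)" by (intro b(2) x) (simp add: space_policy[OF x])
      with b(1) show "\<bar>cost M (x, a)\<bar> \<le> cost M (x, a) + 2 * b" by linarith
    qed (use i in auto)
    also have "\<dots> = mean_cost x + 2 * b" using i by (simp add: mean_cost_def prob_space)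
    also have "\<dots> \<le> C * w x + 2 * b * w x"
      using C(2)[OF x] w_ge_1[OF x] b(1) policy_cost_eq[OF x]
      by (intro add_mono) (auto simp: mult_le_cancel_left1)
    finally show ?thesis by (simp add: algebra_simps)
  qed
  with C(1) b(1) show ?thesis by (intro that[of "C + 2 * b"]) auto
qed

lemma abs_mean_cost_le: "\<bar>mean_cost x\<bar> \<le> (\<integral>a. \<bar>cost M (x, a)\<bar> \<partial>\<pi> x)"
  unfolding mean_cost_def by (rule integral_abs_bound)

lemma integral_pair_kernel:
  fixes f :: "'s \<times> 'a \<Rightarrow> real"
  assumes "x \<in> state_set M" "f \<in> borel_measurable (pair_space M)"
  shows "(\<integral>p. f p \<partial>pair_kernel x) = (\<integral>a. f (x, a) \<partial>\<pi> x)"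
  unfolding pair_kernel_eq_distr[OF assms(1)]
  by (rule integral_distr[OF measurable_Pair_policy[OF assms(1)] assms(2)])

lemma wbounded_mean_cost: "wbounded S w mean_cost"
proof -
  obtain C where C: "0 \<le> C" "\<And>x. x \<in> state_set M \<Longrightarrow> (\<integral>a. \<bar>cost M (x, a)\<bar> \<partial>\<pi> x) \<le> C * w x"
    by (rule abs_cost_bound) blast
  have "(\<lambda>x. \<integral>p. cost M p \<partial>pair_kernel x) \<in> borel_measurable S"
    by (rule measurable_compose[OF measurable_prob_algebraD[OF measurable_pair_kernel]
          integral_measurable_subprob_algebra[OF measurable_cost]])
  then have "mean_cost \<in> borel_measurable S"
    by (rule measurable_cong[THEN iffD1, rotated])
       (simp add: mean_cost_def integral_pair_kernel measurable_cost)
  moreover have "\<bar>mean_cost x\<bar> \<le> C * w x" if "x \<in> state_set M" for x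
    using abs_mean_cost_le[of x] C(2)[OF that] by simp
  ultimately show ?thesis using C(1) by (auto simp: wbounded_def)
qed

lemma
  assumes x: "x \<in> state_set M"
  shows w_integrable_kernel: "integrable (policy_kernel M \<pi> x) w"
    and w_integral_kernel_le: "(\<integral>y. w y \<partial>policy_kernel M \<pi> x) \<le> \<kappa> * w x"
proof -
  have le: "ext_integral (policy_kernel M \<pi> x) (\<lambda>y. ereal (w y)) \<le> ereal (\<kappa> * w x)"
    using stable x by (simp add: stable_policies_def)
  then show i: "integrable (policy_kernel M \<pi> x) w"
    using w_ge_1 w_measurable
    by (intro integrable_if_ext_integral_finite[where b=1] prob_space.finite_measure
          prob_space_policy_kernel x)
       (auto simp: space_policy_kernel[OF x] sets_policy_kernel[OF x] cong: measurable_cong_sets)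
  show "(\<integral>y. w y \<partial>policy_kernel M \<pi> x) \<le> \<kappa> * w x"
    using le by (simp add: ext_integral_eq_integral[OF i])
qed

lemma wbounded_integrable:
  assumes u: "wbounded S w u" and N: "integrable N w" "sets N = sets S"
  shows "integrable N u"
proof -
  obtain C where C: "\<forall>x\<in>state_set M. \<bar>u x\<bar> \<le> C * w x" and [measurable]: "u \<in> borel_measurable S"
    using u by (auto simp: wbounded_def)
  have sp: "space N = state_set M" using sets_eq_imp_space_eq[OF N(2)] by simp
  show ?thesis
  proof (rule Bochner_Integration.integrable_bound)
    show "integrable N (\<lambda>x. C * w x)" using N(1) by simp
    show "u \<in> borel_measurable N"
      using u N(2) by (simp add: wbounded_def cong: measurable_cong_sets)
    show "AE x in N. norm (u x) \<le> norm (C * w x)"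
      using C by (intro AE_I2) (force simp: sp)
  qed
qed

lemma kernel_integrable:
  "x \<in> state_set M \<Longrightarrow> wbounded S w u \<Longrightarrow> integrable (policy_kernel M \<pi> x) u"
  by (rule wbounded_integrable[OF _ w_integrable_kernel sets_policy_kernel])

lemma integral_kernel_le:
  assumes x: "x \<in> state_set M" and u: "wbounded S w u" and C: "0 \<le> C"
    and le: "\<And>y. y \<in> state_set M \<Longrightarrow> u y \<le> C * w y"
  shows "(\<integral>y. u y \<partial>policy_kernel M \<pi> x) \<le> C * \<kappa> * w x"
proof -
  have "(\<integral>y. u y \<partial>policy_kernel M \<pi> x) \<le> (\<integral>y. C * w y \<partial>policy_kernel M \<pi> x)"
    using le w_integrable_kernel[OF x] kernel_integrable[OF x u]
    by (intro integral_mono) (auto simp: space_policy_kernel[OF x])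
  also have "\<dots> \<le> C * (\<kappa> * w x)"
    using mult_left_mono[OF w_integral_kernel_le[OF x] C] by simp
  finally show ?thesis by (simp add: mult.assoc)
qed

lemma wbounded_integral_kernel:
  assumes u: "wbounded S w u"
  shows "wbounded S w (\<lambda>x. \<integral>y. u y \<partial>policy_kernel M \<pi> x)"
proof -
  obtain C where C: "0 \<le> C" "\<And>x. x \<in> state_set M \<Longrightarrow> \<bar>u x\<bar> \<le> C * w x" and um: "u \<in> borel_measurable S"
    using u by (auto simp: wbounded_def)
  have u': "wbounded S w (\<lambda>x. - u x)" using u by (simp add: wbounded_def)
  have "\<bar>\<integral>y. u y \<partial>policy_kernel M \<pi> x\<bar> \<le> C * \<kappa> * w x" if x: "x \<in> state_set M" for x
    using integral_kernel_le[OF x u C(1)] integral_kernel_le[OF x u' C(1)] C(2)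
    by (auto simp: abs_le_iff)
  moreover have "(\<lambda>x. \<integral>y. u y \<partial>policy_kernel M \<pi> x) \<in> borel_measurable S"
    by (rule measurable_compose[OF measurable_prob_algebraD[OF measurable_policy_kernel]
          integral_measurable_subprob_algebra[OF um]])
  ultimately show ?thesis using C(1) \<kappa>_pos
    by (auto simp: wbounded_def intro!: exI[of _ "C * \<kappa>"])
qed

lemma wbounded_bellman_real: "wbounded S w u \<Longrightarrow> wbounded S w (bellman_real u)"
  unfolding bellman_real_def[abs_def]
  by (intro wbounded_add wbounded_mean_cost wbounded_cmult wbounded_integral_kernel)

lemma bellman_real_diff:
  assumes "wbounded S w u" "wbounded S w v" "x \<in> state_set M"
  shows "bellman_real u x - bellman_real v x = discount M * (\<integral>y. u y - v y \<partial>policy_kernel M \<pi> x)"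
  using kernel_integrable[OF assms(3,1)] kernel_integrable[OF assms(3,2)]
  by (simp add: bellman_real_def algebra_simps)

lemma bellman_real_contraction:
  assumes u: "wbounded S w u" and v: "wbounded S w v" and x: "x \<in> state_set M" and C: "0 \<le> C"
    and le: "\<And>y. y \<in> state_set M \<Longrightarrow> \<bar>u y - v y\<bar> \<le> C * w y"
  shows "\<bar>bellman_real u x - bellman_real v x\<bar> \<le> discount M * \<kappa> * C * w x"
proof -
  have *: "bellman_real u x - bellman_real v x \<le> discount M * \<kappa> * C * w x"
    if u: "wbounded S w u" and v: "wbounded S w v" 
      and le: "\<And>y. y \<in> state_set M \<Longrightarrow> \<bar>u y - v y\<bar> \<le> C * w y" for u v
  proof -
    have "wbounded S w (\<lambda>y. u y - v y)"
      by (rule wbounded_diff[OF u v])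
    then have "(\<integral>y. u y - v y \<partial>policy_kernel M \<pi> x) \<le> C * \<kappa> * w x"
      using le by (intro integral_kernel_le x C) (auto simp: abs_le_iff)
    from mult_left_mono[OF this, of "discount M"] discount show ?thesis
      by (simp add: bellman_real_diff[OF u v x] mult_ac)
  qed
  show ?thesis
    using *[OF u v le] *[OF v u] le by (auto simp: abs_le_iff abs_minus_commute)
qed

lemma bellman_eq_bellman_real:
  assumes "wbounded S w u" and v: "\<And>y. y \<in> state_set M \<Longrightarrow> v y = ereal (u y)" and x: "x \<in> state_set M"
  shows "bellman M \<pi> v x = ereal (bellman_real u x)"
proof -
  have "ext_integral (policy_kernel M \<pi> x) v = ext_integral (policy_kernel M \<pi> x) (\<lambda>y. ereal (u y))"
    using v by (intro ext_integral_cong_AE AE_I2) (simp add: space_policy_kernel[OF x])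
  also have "\<dots> = ereal (\<integral>y. u y \<partial>policy_kernel M \<pi> x)"
    by (rule ext_integral_eq_integral[OF kernel_integrable[OF x assms(1)]])
  finally show ?thesis by (simp add: bellman_def bellman_real_def policy_cost_eq[OF x])
qed

text \<open>
  Averaging over actions cannot beat the best action.  The fibrewise integrals of \<open>u\<close> are only
  known to exist for almost every action, which is enough after integrating against \<open>\<pi> x\<close>.
\<close>

lemma bellman_opt_le_bellman_real:
  assumes u: "wbounded S w u" and v: "\<And>y. y \<in> state_set M \<Longrightarrow> v y = ereal (u y)" and x: "x \<in> state_set M"
    and opt: "bellman_opt M v x = ereal m"
  shows "m \<le> bellman_real u x"
proof -
  interpret prob_space "\<pi> x" by (rule prob_space_policy[OF x])
  have K: "(\<lambda>a. kernel M (x, a)) \<in> \<pi> x \<rightarrow>\<^sub>M subprob_algebra S"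
    using measurable_prob_algebraD[OF measurable_kernel_section[OF x]]
    by (simp add: measurable_cong_sets[OF sets_policy[OF x] refl])
  have int: "integrable (\<pi> x \<bind> (\<lambda>a. kernel M (x, a))) u"
    using kernel_integrable[OF x u]
    by (simp add: policy_kernel_def)
  note k = AE_integrable_kernel[OF K not_empty int] integrable_integral_kernel[OF K not_empty int]
    integral_bind_integrable[OF K not_empty int]
  have "AE a in \<pi> x. m \<le> cost M (x, a) + discount M * (\<integral>y. u y \<partial>kernel M (x, a))"
    using k(1) AE_space
  proof eventually_elim
    case (elim a)
    then have a: "a \<in> action_set M" by (simp add: space_policy[OF x])
    have "space (kernel M (x, a)) = state_set M"
      using subprob_measurableD(1)[OF K elim(2)] by simp
    then have "ext_integral (kernel M (x, a)) v = ext_integral (kernel M (x, a)) (\<lambda>y. ereal (u y))"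
      using v by (intro ext_integral_cong_AE AE_I2) simp
    also have "\<dots> = ereal (\<integral>y. u y \<partial>kernel M (x, a))"
      by (rule ext_integral_eq_integral[OF elim(1)])
    finally have e: "ext_integral (kernel M (x, a)) v = ereal (\<integral>y. u y \<partial>kernel M (x, a))" .
    have "ereal m \<le> ereal (cost M (x, a)) + ereal (discount M) * ext_integral (kernel M (x, a)) v"
      unfolding opt[symmetric] bellman_opt_def by (rule INF_lower[OF a])
    then show ?case by (simp add: e)
  qed
  then have "(\<integral>a. m \<partial>\<pi> x) \<le> (\<integral>a. cost M (x, a) + discount M * (\<integral>y. u y \<partial>kernel M (x, a)) \<partial>\<pi> x)"
    using k(2) cost_integrable[OF x] by (intro integral_mono_AE) auto
  also have "\<dots> = bellman_real u x"
    using k(2) cost_integrable[OF x] by (simp add: bellman_real_def mean_cost_def policy_kernel_def k(3))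
  finally show ?thesis by (simp add: prob_space)
qed

section \<open>The performance difference formula\<close>

context
  fixes s assumes s: "s \<in> state_set M"
begin

text \<open>
  Iterated stability: each step inflates the expected weight by at most \<open>\<kappa>\<close>.  Together with
  \<open>\<gamma> * \<kappa> < 1\<close> this makes every discounted series below geometrically dominated.
\<close>

lemma nn_integral_w_state_law: "(\<integral>\<^sup>+ x. ennreal (w x) \<partial>state_law M \<pi> s n) \<le> ennreal (\<kappa> ^ n * w s)"
proof (induction n)
  case 0
  show ?case using s by (simp add: nn_integral_return)
next
  case (Suc n)
  have "(\<integral>\<^sup>+ x. ennreal (w x) \<partial>state_law M \<pi> s (Suc n))
      = (\<integral>\<^sup>+ x. \<integral>\<^sup>+ y. ennreal (w y) \<partial>policy_kernel M \<pi> x \<partial>state_law M \<pi> s n)"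
    unfolding state_law.simps by (rule nn_integral_bind[OF _ policy_kernel_subprob[OF s]]) simp
  also have "\<dots> \<le> (\<integral>\<^sup>+ x. ennreal \<kappa> * ennreal (w x) \<partial>state_law M \<pi> s n)"
  proof (rule nn_integral_mono)
    fix x assume "x \<in> space (state_law M \<pi> s n)"
    then have x: "x \<in> state_set M" by (simp add: space_state_law[OF s])
    have "(\<integral>\<^sup>+ y. ennreal (w y) \<partial>policy_kernel M \<pi> x) = ennreal (\<integral>y. w y \<partial>policy_kernel M \<pi> x)"
      using w_pos by (intro nn_integral_eq_integral w_integrable_kernel x AE_I2)
        (auto simp: space_policy_kernel[OF x] less_imp_le)
    also have "\<dots> \<le> ennreal (\<kappa> * w x)" by (rule ennreal_leI[OF w_integral_kernel_le[OF x]])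
    finally show "(\<integral>\<^sup>+ y. ennreal (w y) \<partial>policy_kernel M \<pi> x) \<le> ennreal \<kappa> * ennreal (w x)"
      using \<kappa>_pos w_pos[OF x] by (simp add: ennreal_mult)
  qed
  also have "\<dots> = ennreal \<kappa> * (\<integral>\<^sup>+ x. ennreal (w x) \<partial>state_law M \<pi> s n)"
    by (rule nn_integral_cmult) (simp add: measurable_state_law_iff[OF s])
  also have "\<dots> \<le> ennreal \<kappa> * ennreal (\<kappa> ^ n * w s)" by (intro mult_left_mono Suc) simp
  also have "\<dots> = ennreal (\<kappa> ^ Suc n * w s)"
    using \<kappa>_pos w_pos[OF s] by (simp add: ennreal_mult[symmetric] mult.assoc)
  finally show ?case .
qed

lemma
  shows w_integrable_state_law: "integrable (state_law M \<pi> s n) w"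
    and w_integral_state_law_le: "(\<integral>x. w x \<partial>state_law M \<pi> s n) \<le> \<kappa> ^ n * w s"
proof -
  have m: "w \<in> borel_measurable (state_law M \<pi> s n)" by (simp add: measurable_state_law_iff[OF s])
  have nn: "AE x in state_law M \<pi> s n. 0 \<le> w x"
    using w_pos by (intro AE_I2) (auto simp: space_state_law[OF s] less_imp_le)
  show i: "integrable (state_law M \<pi> s n) w"
    using nn_integral_w_state_law[of n] by (intro integrableI_nonneg m nn) (auto simp: le_less_trans)
  show "(\<integral>x. w x \<partial>state_law M \<pi> s n) \<le> \<kappa> ^ n * w s"
    using nn_integral_w_state_law[of n] \<kappa>_pos w_pos[OF s]
    by (simp add: nn_integral_eq_integral[OF i nn])
qed

lemma integrable_state_law: "wbounded S w u \<Longrightarrow> integrable (state_law M \<pi> s n) u"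
  by (rule wbounded_integrable[OF _ w_integrable_state_law sets_state_law[OF s]])

lemma integral_state_law_le:
  assumes u: "wbounded S w u" and C: "0 \<le> C" and le: "\<And>y. y \<in> state_set M \<Longrightarrow> u y \<le> C * w y"
  shows "(\<integral>y. u y \<partial>state_law M \<pi> s n) \<le> C * w s * \<kappa> ^ n"
proof -
  have "(\<integral>y. u y \<partial>state_law M \<pi> s n) \<le> (\<integral>y. C * w y \<partial>state_law M \<pi> s n)"
    using le w_integrable_state_law integrable_state_law[OF u]
    by (intro integral_mono) (auto simp: space_state_law[OF s])
  also have "\<dots> \<le> C * (\<kappa> ^ n * w s)"
    using mult_left_mono[OF w_integral_state_law_le C] by simp
  finally show ?thesis by (simp add: mult_ac)
qed

lemma integral_state_law_Suc:
  assumes u: "wbounded S w u"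
  shows "(\<integral>x. u x \<partial>state_law M \<pi> s (Suc n))
    = (\<integral>x. \<integral>y. u y \<partial>policy_kernel M \<pi> x \<partial>state_law M \<pi> s n)"
  using integral_bind_integrable[OF policy_kernel_subprob[OF s]
      prob_space.not_empty[OF prob_space_state_law[OF s]], of n u] integrable_state_law[OF u, of "Suc n"]
  by simp

lemma nn_integral_abs_cost_trajectory:
  assumes C: "0 \<le> C" "\<And>x. x \<in> state_set M \<Longrightarrow> (\<integral>a. \<bar>cost M (x, a)\<bar> \<partial>\<pi> x) \<le> C * w x"
  shows "(\<integral>\<^sup>+ \<omega>. ennreal \<bar>cost M (\<omega> n)\<bar> \<partial>trajectory_law M \<pi> s) \<le> ennreal (C * w s * \<kappa> ^ n)"
proof -
  have [measurable]: "cost M \<in> borel_measurable (pair_space M)" by (rule measurable_cost)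
  have "(\<integral>\<^sup>+ \<omega>. ennreal \<bar>cost M (\<omega> n)\<bar> \<partial>trajectory_law M \<pi> s)
      = (\<integral>\<^sup>+ p. ennreal \<bar>cost M p\<bar> \<partial>attach_action M \<pi> (state_law M \<pi> s n))"
    unfolding distr_trajectory_law[OF s, symmetric]
    by (rule nn_integral_distr[OF measurable_coordinate[OF s], symmetric]) measurable
  also have "\<dots> = (\<integral>\<^sup>+ x. \<integral>\<^sup>+ p. ennreal \<bar>cost M p\<bar> \<partial>pair_kernel x \<partial>state_law M \<pi> s n)"
    unfolding attach_action_eq by (rule nn_integral_bind[OF _ pair_kernel_subprob[OF s]]) measurable
  also have "\<dots> \<le> (\<integral>\<^sup>+ x. ennreal C * ennreal (w x) \<partial>state_law M \<pi> s n)"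
  proof (rule nn_integral_mono)
    fix x assume "x \<in> space (state_law M \<pi> s n)"
    then have x: "x \<in> state_set M" by (simp add: space_state_law[OF s])
    have "(\<integral>\<^sup>+ p. ennreal \<bar>cost M p\<bar> \<partial>pair_kernel x) = (\<integral>\<^sup>+ a. ennreal \<bar>cost M (x, a)\<bar> \<partial>\<pi> x)"
      unfolding pair_kernel_eq_distr[OF x]
      by (rule nn_integral_distr[OF measurable_Pair_policy[OF x]]) measurable
    also have "\<dots> = ennreal (\<integral>a. \<bar>cost M (x, a)\<bar> \<partial>\<pi> x)"
      using cost_integrable[OF x] by (intro nn_integral_eq_integral) auto
    also have "\<dots> \<le> ennreal (C * w x)" by (rule ennreal_leI[OF C(2)[OF x]])
    finally show "(\<integral>\<^sup>+ p. ennreal \<bar>cost M p\<bar> \<partial>pair_kernel x) \<le> ennreal C * ennreal (w x)"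
      using C(1) w_pos[OF x] by (simp add: ennreal_mult)
  qed
  also have "\<dots> = ennreal C * (\<integral>\<^sup>+ x. ennreal (w x) \<partial>state_law M \<pi> s n)"
    by (rule nn_integral_cmult) (simp add: measurable_state_law_iff[OF s])
  also have "\<dots> \<le> ennreal C * ennreal (\<kappa> ^ n * w s)"
    by (intro mult_left_mono nn_integral_w_state_law) simp
  also have "\<dots> = ennreal (C * w s * \<kappa> ^ n)"
    using \<kappa>_pos w_pos[OF s] C(1) by (simp add: ennreal_mult[symmetric] mult_ac)
  finally show ?thesis .
qed

lemma integrable_cost_trajectory: "integrable (trajectory_law M \<pi> s) (\<lambda>\<omega>. cost M (\<omega> n))"
proof -
  obtain C where C: "0 \<le> C" "\<And>x. x \<in> state_set M \<Longrightarrow> (\<integral>a. \<bar>cost M (x, a)\<bar> \<partial>\<pi> x) \<le> C * w x"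
    by (rule abs_cost_bound) blast
  show ?thesis
    using nn_integral_abs_cost_trajectory[OF C, of n]
      measurable_compose[OF measurable_coordinate[OF s] measurable_cost]
    by (intro integrableI_bounded) (auto simp: le_less_trans)
qed

lemma integral_cost_trajectory:
  "(\<integral>\<omega>. cost M (\<omega> n) \<partial>trajectory_law M \<pi> s) = (\<integral>x. mean_cost x \<partial>state_law M \<pi> s n)"
proof -
  let ?A = "attach_action M \<pi> (state_law M \<pi> s n)"
  have i: "integrable ?A (cost M)"
    unfolding distr_trajectory_law[OF s, symmetric]
    by (subst integrable_distr_eq[OF measurable_coordinate[OF s] measurable_cost])
       (rule integrable_cost_trajectory)
  have "(\<integral>\<omega>. cost M (\<omega> n) \<partial>trajectory_law M \<pi> s) = (\<integral>p. cost M p \<partial>?A)"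
    unfolding distr_trajectory_law[OF s, symmetric]
    by (rule integral_distr[OF measurable_coordinate[OF s] measurable_cost, symmetric])
  also have "\<dots> = (\<integral>x. \<integral>p. cost M p \<partial>pair_kernel x \<partial>state_law M \<pi> s n)"
    using i unfolding attach_action_eq
    by (rule integral_bind_integrable[OF pair_kernel_subprob[OF s]
          prob_space.not_empty[OF prob_space_state_law[OF s]]])
  also have "\<dots> = (\<integral>x. mean_cost x \<partial>state_law M \<pi> s n)"
    by (rule Bochner_Integration.integral_cong[OF refl])
       (simp add: mean_cost_def integral_pair_kernel measurable_cost space_state_law[OF s])
  finally show ?thesis .
qed

lemma
  shows summable_stage_costs: "summable (\<lambda>n. discount M ^ n * (\<integral>x. mean_cost x \<partial>state_law M \<pi> s n))"
    and policy_value_eq_value_real: "policy_value M \<pi> s = ereal (value_real s)"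
proof -
  let ?L = "trajectory_law M \<pi> s" and ?f = "\<lambda>n \<omega>. discount M ^ n * cost M (\<omega> n)"
  obtain C where C: "0 \<le> C" "\<And>x. x \<in> state_set M \<Longrightarrow> (\<integral>a. \<bar>cost M (x, a)\<bar> \<partial>\<pi> x) \<le> C * w x"
    by (rule abs_cost_bound) blast
  have i: "integrable ?L (?f n)" for n using integrable_cost_trajectory by simp
  have eq: "(\<integral>\<omega>. ?f n \<omega> \<partial>?L) = discount M ^ n * (\<integral>x. mean_cost x \<partial>state_law M \<pi> s n)" for n
    by (simp add: integral_cost_trajectory)
  have le: "(\<integral>\<omega>. \<bar>?f n \<omega>\<bar> \<partial>?L) \<le> C * w s * (discount M * \<kappa>) ^ n" for n
  proof -
    have "ennreal (\<integral>\<omega>. \<bar>cost M (\<omega> n)\<bar> \<partial>?L) \<le> ennreal (C * w s * \<kappa> ^ n)"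
      using nn_integral_abs_cost_trajectory[OF C, of n] integrable_cost_trajectory[of n]
      by (simp add: nn_integral_eq_integral)
    then have "(\<integral>\<omega>. \<bar>cost M (\<omega> n)\<bar> \<partial>?L) \<le> C * w s * \<kappa> ^ n"
      using C(1) \<kappa>_pos w_pos[OF s] by (simp add: ennreal_le_iff)
    from mult_left_mono[OF this, of "discount M ^ n"] show ?thesis
      using discount by (simp add: abs_mult power_mult_distrib mult_ac)
  qed
  have "summable (\<lambda>n. C * w s * (discount M * \<kappa>) ^ n)"
    using contraction discount \<kappa>_pos by (intro summable_mult summable_geometric) simp
  then have sum: "summable (\<lambda>n. \<integral>\<omega>. \<bar>?f n \<omega>\<bar> \<partial>?L)"
    by (rule summable_comparison_test'[where N=0]) (use le in auto)
  show "summable (\<lambda>n. discount M ^ n * (\<integral>x. mean_cost x \<partial>state_law M \<pi> s n))"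
    using summable_integral_if_abs[OF i sum] unfolding eq .
  show "policy_value M \<pi> s = ereal (value_real s)"
    using ext_integral_suminf[OF i sum] unfolding eq policy_value_def value_real_def .
qed

text \<open>
  The gap between the value of a policy and a weighted-bounded function \<open>u\<close> is the discounted sum of the
  expected Bellman residuals of \<open>u\<close>: substituting the definition of the residual, the terms in
  \<open>u\<close> telescope to \<open>- u s\<close> because the discounted expectation of \<open>u\<close> under the state law
  decays like \<open>(\<gamma> * \<kappa>) ^ n\<close>.
\<close>

lemma performance_difference:
  assumes u: "wbounded S w u"
  shows "(\<lambda>n. discount M ^ n * (\<integral>x. bellman_real u x - u x \<partial>state_law M \<pi> s n)) sums (value_real s - u s)"
proof -
  define h where "h n = discount M ^ n * (\<integral>x. u x \<partial>state_law M \<pi> s n)" for n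
  obtain C where C: "0 \<le> C" "\<And>x. x \<in> state_set M \<Longrightarrow> \<bar>u x\<bar> \<le> C * w x"
    using u by (auto simp: wbounded_def)
  have "\<bar>h n\<bar> \<le> C * w s * (discount M * \<kappa>) ^ n" for n
  proof -
    have "wbounded S w (\<lambda>x. - u x)" using u by (simp add: wbounded_def)
    then have "\<bar>\<integral>x. u x \<partial>state_law M \<pi> s n\<bar> \<le> C * w s * \<kappa> ^ n"
      using integral_state_law_le[OF u C(1)] integral_state_law_le[of "\<lambda>x. - u x", OF _ C(1)] C(2)
      by (auto simp: abs_le_iff)
    from mult_left_mono[OF this, of "discount M ^ n"] show ?thesis
      using discount by (simp add: h_def abs_mult power_mult_distrib mult_ac)
  qed
  moreover have "(\<lambda>n. C * w s * (discount M * \<kappa>) ^ n) \<longlonglongrightarrow> 0"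
    using contraction discount \<kappa>_pos by (intro tendsto_mult_right_zero LIMSEQ_power_zero) simp
  ultimately have "h \<longlonglongrightarrow> 0"
    by (intro Lim_null_comparison[where f=h and g="\<lambda>n. C * w s * (discount M * \<kappa>) ^ n"]) auto
  then have tele: "(\<lambda>n. h (Suc n) - h n) sums (0 - h 0)" by (rule telescope_sums)
  have h0: "h 0 = u s"
    using u s by (simp add: h_def integral_return wbounded_def)
  have "(\<lambda>n. discount M ^ n * (\<integral>x. mean_cost x \<partial>state_law M \<pi> s n)) sums value_real s"
    unfolding value_real_def by (rule summable_sums[OF summable_stage_costs])
  from sums_add[OF this tele]
  have sums: "(\<lambda>n. discount M ^ n * (\<integral>x. mean_cost x \<partial>state_law M \<pi> s n) + (h (Suc n) - h n)) sums (value_real s - u s)"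
    by (simp add: h0)
  have "discount M ^ n * (\<integral>x. mean_cost x \<partial>state_law M \<pi> s n) + (h (Suc n) - h n)
      = discount M ^ n * (\<integral>x. bellman_real u x - u x \<partial>state_law M \<pi> s n)" for n
    using integrable_state_law[OF wbounded_mean_cost, of n] integrable_state_law[OF u, of n]
      integrable_state_law[OF wbounded_integral_kernel[OF u], of n]
    by (simp add: h_def bellman_real_def integral_state_law_Suc[OF u] algebra_simps del: state_law.simps)
  with sums show ?thesis by simp
qed

text \<open>
  A one-sided residual bound gives a one-sided value bound, by summing the geometric series of
  expected weights.  The two sides are kept apart because comparisons with the optimal Bellman operator
  provide only one of them.
\<close>

lemma value_real_le:
  assumes u: "wbounded S w u" and K: "0 \<le> K"
    and le: "\<And>x. x \<in> state_set M \<Longrightarrow> bellman_real u x - u x \<le> K * w x"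
  shows "value_real s - u s \<le> K * w s / (1 - discount M * \<kappa>)"
proof (rule sums_le[OF _ performance_difference[OF u]])
  have "wbounded S w (\<lambda>x. bellman_real u x - u x)"
    by (intro wbounded_diff wbounded_bellman_real u)
  from integral_state_law_le[OF this K le]
  show "discount M ^ n * (\<integral>x. bellman_real u x - u x \<partial>state_law M \<pi> s n) \<le> K * w s * (discount M * \<kappa>) ^ n" for n
    using mult_left_mono[of "\<integral>x. bellman_real u x - u x \<partial>state_law M \<pi> s n" "K * w s * \<kappa> ^ n" "discount M ^ n"] discount
    by (simp add: power_mult_distrib mult_ac)
  have "(\<lambda>n. (discount M * \<kappa>) ^ n) sums (1 / (1 - discount M * \<kappa>))"
    using contraction discount \<kappa>_pos by (intro geometric_sums) simp
  from sums_mult[OF this, of "K * w s"]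
  show "(\<lambda>n. K * w s * (discount M * \<kappa>) ^ n) sums (K * w s / (1 - discount M * \<kappa>))" by simp
qed

lemma value_real_ge:
  assumes u: "wbounded S w u" and K: "0 \<le> K"
    and le: "\<And>x. x \<in> state_set M \<Longrightarrow> u x - bellman_real u x \<le> K * w x"
  shows "u s - value_real s \<le> K * w s / (1 - discount M * \<kappa>)"
proof (rule sums_le)
  have "wbounded S w (\<lambda>x. u x - bellman_real u x)"
    by (intro wbounded_diff wbounded_bellman_real u)
  from integral_state_law_le[OF this K le]
  show "discount M ^ n * (\<integral>x. u x - bellman_real u x \<partial>state_law M \<pi> s n) \<le> K * w s * (discount M * \<kappa>) ^ n" for n
    using mult_left_mono[of "\<integral>x. u x - bellman_real u x \<partial>state_law M \<pi> s n" "K * w s * \<kappa> ^ n" "discount M ^ n"] discount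
    by (simp add: power_mult_distrib mult_ac)
  have "(\<lambda>n. (discount M * \<kappa>) ^ n) sums (1 / (1 - discount M * \<kappa>))"
    using contraction discount \<kappa>_pos by (intro geometric_sums) simp
  from sums_mult[OF this, of "K * w s"]
  show "(\<lambda>n. K * w s * (discount M * \<kappa>) ^ n) sums (K * w s / (1 - discount M * \<kappa>))" by simp
  have "discount M ^ n * (\<integral>x. u x - bellman_real u x \<partial>state_law M \<pi> s n)
      = - (discount M ^ n * (\<integral>x. bellman_real u x - u x \<partial>state_law M \<pi> s n))" for n
    using integrable_state_law[OF wbounded_bellman_real[OF u], of n] integrable_state_law[OF u, of n]
    by (simp add: algebra_simps)
  then show "(\<lambda>n. discount M ^ n * (\<integral>x. u x - bellman_real u x \<partial>state_law M \<pi> s n)) sums (u s - value_real s)"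
    using sums_minus[OF performance_difference[OF u]] by simp
qed

lemma value_real_dist:
  assumes u: "wbounded S w u" and K: "0 \<le> K"
    and le: "\<And>x. x \<in> state_set M \<Longrightarrow> \<bar>bellman_real u x - u x\<bar> \<le> K * w x"
  shows "\<bar>value_real s - u s\<bar> \<le> K * w s / (1 - discount M * \<kappa>)"
  using value_real_le[OF u K] value_real_ge[OF u K] le by (auto simp: abs_le_iff)

text \<open>
  Uniqueness of the fixed point in the weighted space; applied to an optimal value function, it shows
  that a stable greedy policy attains it.
\<close>

lemma value_real_eq_fixed_point:
  assumes "wbounded S w u" "\<And>x. x \<in> state_set M \<Longrightarrow> bellman_real u x = u x"
  shows "value_real s = u s"
  using value_real_dist[OF assms(1), of 0] assms(2) by simp

end

end

section \<open>Comparing two models\<close>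

lemma weighted_value_function_real:
  assumes v: "v \<in> weighted_value_functions M c_min w"
    and w: "\<And>x. x \<in> state_set M \<Longrightarrow> 1 \<le> w x"
  shows "\<exists>u. wbounded (state_space M) w u \<and> (\<forall>x\<in>state_set M. v x = ereal (u x))"
proof -
  obtain C where C: "0 \<le> C" "wnorm (state_set M) w v = ennreal C"
    using v by (cases "wnorm (state_set M) w v") (auto simp: weighted_value_functions_def)
  have le: "e2ennreal (\<bar>v x\<bar> / ereal (w x)) \<le> ennreal C" if "x \<in> state_set M" for x
    unfolding C(2)[symmetric] wnorm_def by (rule SUP_upper[OF that])
  have fin: "\<bar>v x\<bar> \<noteq> \<infinity>" if x: "x \<in> state_set M" for x
    using le[OF x] w[OF x] by (cases "v x") (auto simp: top_unique)
  then have eq: "v x = ereal (real_of_ereal (v x))" if "x \<in> state_set M" for x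
    using that by (simp add: ereal_real)
  have "\<bar>real_of_ereal (v x)\<bar> \<le> C * w x" if x: "x \<in> state_set M" for x
    using le[OF x] w[OF x] C(1) fin[OF x]
    by (cases "v x") (auto simp: ennreal_le_iff field_simps)
  moreover have "v \<in> borel_measurable (state_space M)"
    using v by (simp add: weighted_value_functions_def value_functions_def)
  ultimately have "wbounded (state_space M) w (\<lambda>x. real_of_ereal (v x))"
    using C(1) by (auto simp: wbounded_def)
  with eq show ?thesis by blast
qed

text \<open>
  Stability makes the Bellman operators of individual policies contract, but says nothing about the
  infimum over all actions, so each side of the estimate goes through a stable policy.  From above, \<open>u\<close> is at
  most the value of \<open>\<rho>\<close>, whose residual at \<open>z\<close> is that of the optimal operator.  From below,
  \<open>u\<close> is the value of \<open>\<pi>\<close>, and the Bellman operator of \<open>\<pi>\<close> dominates the optimal one.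
\<close>

lemma optimal_value_dist:
  assumes \<pi>: "stable_policy M \<pi> w \<kappa>" "\<pi> \<in> greedy M V"
    and \<rho>: "stable_policy M \<rho> w \<kappa>" "\<rho> \<in> greedy M v"
    and V: "is_optimal_value M c_min w V" "wbounded (state_space M) w u"
      "\<And>x. x \<in> state_set M \<Longrightarrow> V x = ereal (u x)"
    and v: "wbounded (state_space M) w z" "\<And>x. x \<in> state_set M \<Longrightarrow> v x = ereal (z x)"
    and b: "\<And>x. x \<in> state_set M \<Longrightarrow> bellman_opt M v x = ereal (b x)"
    and K: "0 \<le> K" "\<And>x. x \<in> state_set M \<Longrightarrow> \<bar>b x - z x\<bar> \<le> K * w x"
    and s: "s \<in> state_set M"
  shows "\<bar>u s - z s\<bar> \<le> K * w s / (1 - discount M * \<kappa>)"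
proof -
  interpret P: stable_policy M \<pi> w \<kappa> by fact
  interpret R: stable_policy M \<rho> w \<kappa> by fact
  have "P.bellman_real u x = u x" if x: "x \<in> state_set M" for x
  proof -
    have "ereal (P.bellman_real u x) = bellman_opt M V x"
      using \<pi>(2) x P.bellman_eq_bellman_real[OF V(2,3) x] by (simp add: greedy_def)
    also have "\<dots> = ereal (u x)" using V(1) V(3)[OF x] x by (simp add: is_optimal_value_def)
    finally show ?thesis by simp
  qed
  then have u: "P.value_real s = u s"
    by (rule P.value_real_eq_fixed_point[OF s V(2)])
  have "R.bellman_real z x = b x" if x: "x \<in> state_set M" for x
    using \<rho>(2) x R.bellman_eq_bellman_real[OF v x] b[OF x] by (simp add: greedy_def)
  then have "R.value_real s - z s \<le> K * w s / (1 - discount M * \<kappa>)"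
    using K(2) by (intro R.value_real_le[OF s v(1) K(1)]) (auto simp: abs_le_iff)
  moreover have "u s \<le> R.value_real s"
  proof -
    have "V s \<le> policy_value M \<rho> s"
      using V(1) R.policy s unfolding is_optimal_value_def by blast
    then show ?thesis by (simp add: V(3)[OF s] R.policy_value_eq_value_real[OF s])
  qed
  moreover have "z s - P.value_real s \<le> K * w s / (1 - discount M * \<kappa>)"
  proof (rule P.value_real_ge[OF s v(1) K(1)])
    fix x assume x: "x \<in> state_set M"
    have "b x \<le> P.bellman_real z x" by (rule P.bellman_opt_le_bellman_real[OF v x b[OF x]])
    with K(2)[OF x] show "z x - P.bellman_real z x \<le> K * w x" by linarith
  qed
  ultimately show ?thesis using u by (simp add: abs_le_iff)
qed

theorem theorem1:
  fixes M M' :: "('s::polish_space, 'a::polish_space) mdp"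
    and w :: "'s \<Rightarrow> real" and c_min \<gamma> \<kappa> :: real
    and V V' :: "'s \<Rightarrow> ereal" and \<pi> \<pi>' :: "'s \<Rightarrow> 'a measure"
  assumes "is_mdp M" and "is_mdp M'"
    and "state_set M' = state_set M" and "action_set M' = action_set M"
    and "discount M = \<gamma>" and "discount M' = \<gamma>"
    and "\<And>s a. s \<in> state_set M \<Longrightarrow> a \<in> action_set M \<Longrightarrow> c_min \<le> cost M (s, a)"
    and "\<And>s a. s \<in> state_set M \<Longrightarrow> a \<in> action_set M \<Longrightarrow> c_min \<le> cost M' (s, a)"
    and "w \<in> borel_measurable (state_space M)"
    and "\<And>s. s \<in> state_set M \<Longrightarrow> 1 \<le> w s"
    and "0 < \<kappa>" and "\<gamma> * \<kappa> < 1"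
    and "DP_solvable M c_min w" and "DP_solvable M' c_min w"
    and "is_optimal_value M c_min w V" and "is_optimal_value M' c_min w V'"
    and "\<pi> \<in> greedy M V \<inter> stable_policies M \<kappa> w"
    and "\<pi>' \<in> greedy M' V' \<inter> stable_policies M \<kappa> w \<inter> stable_policies M' \<kappa> w"
  shows
    "(wnorm (state_set M) w (\<lambda>s. policy_value M \<pi>' s - V s)
        \<le> ennreal (1 / (1 - \<gamma> * \<kappa>)) * (mismatch M M' w \<pi>' \<pi>' V' + mismatch M M' w \<pi> \<pi>' V')
      \<and> wnorm (state_set M) w (\<lambda>s. policy_value M \<pi>' s - V s)
        \<le> ennreal (1 / (1 - \<gamma> * \<kappa>)) * mismatch M M' w \<pi>' \<pi>' V
          + ennreal ((1 + \<gamma> * \<kappa>) / (1 - \<gamma> * \<kappa>)\<^sup>2) * mismatch M M' w \<pi> \<pi>' V)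
     \<and> (greedy M V' \<inter> stable_policies M \<kappa> w \<noteq> {} \<longrightarrow>
        wnorm (state_set M) w (\<lambda>s. policy_value M \<pi>' s - V s)
        \<le> ennreal (1 / (1 - \<gamma> * \<kappa>)) * (mismatch M M' w \<pi>' \<pi>' V' + mismatch_opt M M' w V'))
     \<and> (greedy M' V \<inter> stable_policies M' \<kappa> w \<noteq> {} \<longrightarrow>
        wnorm (state_set M) w (\<lambda>s. policy_value M \<pi>' s - V s)
        \<le> ennreal (1 / (1 - \<gamma> * \<kappa>)) * mismatch M M' w \<pi>' \<pi>' V
          + ennreal ((1 + \<gamma> * \<kappa>) / (1 - \<gamma> * \<kappa>)\<^sup>2) * mismatch_opt M M' w V)"
proof -
  note mdp = assms(1,2) and sets_eq = assms(3) and disc = assms(5,6)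
    and w = assms(9,10) and \<kappa> = assms(11,12) and DP = assms(13,14)
    and V = assms(15) and V' = assms(16)
  define q where "q = \<gamma> * \<kappa>"
  have q: "0 < q" "q < 1"
    using \<kappa> mdp(1) disc by (auto simp: q_def is_mdp_def)
  have SS: "state_space M' = state_space M" by (simp add: state_space_def sets_eq)
  have stable: "stable_policy N \<rho> w \<kappa>"
    if "N = M \<or> N = M'" "\<rho> \<in> stable_policies N \<kappa> w" for N \<rho>
    using that mdp sets_eq disc w \<kappa> SS by unfold_locales (auto simp: stable_policies_def)
  interpret P: stable_policy M \<pi> w \<kappa> by (rule stable) (use assms(17) in auto)
  interpret P': stable_policy M \<pi>' w \<kappa> by (rule stable) (use assms(18) in auto)
  interpret Q': stable_policy M' \<pi>' w \<kappa> by (rule stable) (use assms(18) in auto)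
  have weighted: "weighted_value_functions M' c_min w = weighted_value_functions M c_min w"
    by (simp add: weighted_value_functions_def value_functions_def SS sets_eq disc)

  have Vw: "V \<in> weighted_value_functions M c_min w" "V' \<in> weighted_value_functions M c_min w"
    using V V' weighted by (auto simp: is_optimal_value_def)
  obtain u where u: "wbounded P.S w u" "\<And>x. x \<in> state_set M \<Longrightarrow> V x = ereal (u x)"
    using weighted_value_function_real[OF Vw(1) w(2)] by auto
  obtain u' where u': "wbounded P.S w u'" "\<And>x. x \<in> state_set M \<Longrightarrow> V' x = ereal (u' x)"
    using weighted_value_function_real[OF Vw(2) w(2)] by auto
  have opt: "bellman_opt M V x = ereal (u x)" "bellman_opt M' V' x = ereal (u' x)"
    if x: "x \<in> state_set M" for x
    using V V' x u(2)[OF x] u'(2)[OF x] by (simp_all add: is_optimal_value_def sets_eq)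
  have bellman: "bellman M \<pi> v x = ereal (P.bellman_real z x)"
    "bellman M \<pi>' v x = ereal (P'.bellman_real z x)"
    "bellman M' \<pi>' v x = ereal (Q'.bellman_real z x)"
    if "wbounded P.S w z" "\<And>x. x \<in> state_set M \<Longrightarrow> v x = ereal (z x)" "x \<in> state_set M" for v z x
    using that P.bellman_eq_bellman_real[of z v] P'.bellman_eq_bellman_real[of z v]
      Q'.bellman_eq_bellman_real[of z v] by (simp_all add: SS sets_eq)
  have fixed: "P.bellman_real u x = u x" "Q'.bellman_real u' x = u' x" if x: "x \<in> state_set M" for x
    using bellman(1)[OF u x] bellman(3)[OF u' x] opt[OF x] assms(17,18) x
    by (auto simp: greedy_def sets_eq)
  have Q'_wbounded: "wbounded P.S w (Q'.bellman_real z)" if "wbounded P.S w z" for z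
    using Q'.wbounded_bellman_real[of z] that by (simp add: SS)

  have value_diff: "policy_value M \<pi>' x - V x = ereal (P'.value_real x - u x)" if "x \<in> state_set M" for x
    using that by (simp add: P'.policy_value_eq_value_real u(2))
  have goal: "wnorm (state_set M) w (\<lambda>s. policy_value M \<pi>' s - V s) \<le> ennreal K"
    if "0 \<le> K" "\<And>x. x \<in> state_set M \<Longrightarrow> \<bar>P'.value_real x - u x\<bar> \<le> K * w x" for K
  proof -
    have "wnorm (state_set M) w (\<lambda>s. policy_value M \<pi>' s - V s)
        = wnorm (state_set M) w (\<lambda>x. ereal (P'.value_real x - u x))"
      by (rule wnorm_cong[OF value_diff])
    then show ?thesis using that w(2) by (simp add: wnorm_le_iff)
  qed
  have attained: "\<exists>K\<ge>0. wnorm (state_set M) w g = ennreal K \<and> (\<forall>x\<in>state_set M. \<bar>f x\<bar> \<le> K * w x)"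
    if "wbounded P.S w f" "\<And>x. x \<in> state_set M \<Longrightarrow> g x = ereal (f x)" for f g
  proof -
    have "wnorm (state_set M) w g = wnorm (state_set M) w (\<lambda>x. ereal (f x))"
      by (rule wnorm_cong[OF that(2)])
    then show ?thesis using wbounded_wnorm[OF that(1)] w(2) by (metis space_state_space)
  qed

  have mismatches: "\<exists>K\<ge>0. mismatch M M' w \<pi>' \<pi>' v = ennreal K
        \<and> (\<forall>x\<in>state_set M. \<bar>P'.bellman_real z x - Q'.bellman_real z x\<bar> \<le> K * w x)"
    "\<exists>K\<ge>0. mismatch M M' w \<pi> \<pi>' v = ennreal K
        \<and> (\<forall>x\<in>state_set M. \<bar>P.bellman_real z x - Q'.bellman_real z x\<bar> \<le> K * w x)"
    if z: "wbounded P.S w z" "\<And>x. x \<in> state_set M \<Longrightarrow> v x = ereal (z x)" for v z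
    unfolding mismatch_def
    by (intro attained wbounded_diff P.wbounded_bellman_real P'.wbounded_bellman_real Q'_wbounded z(1);
        simp add: bellman[OF z])+

  obtain K\<^sub>1 where K\<^sub>1: "0 \<le> K\<^sub>1" "mismatch M M' w \<pi>' \<pi>' V' = ennreal K\<^sub>1"
    "\<And>x. x \<in> state_set M \<Longrightarrow> \<bar>P'.bellman_real u' x - u' x\<bar> \<le> K\<^sub>1 * w x"
    using mismatches(1)[OF u'] fixed(2) by auto
  obtain K\<^sub>2 where K\<^sub>2: "0 \<le> K\<^sub>2" "mismatch M M' w \<pi> \<pi>' V' = ennreal K\<^sub>2"
    "\<And>x. x \<in> state_set M \<Longrightarrow> \<bar>P.bellman_real u' x - u' x\<bar> \<le> K\<^sub>2 * w x"
    using mismatches(2)[OF u'] fixed(2) by auto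
  obtain L\<^sub>1 where L\<^sub>1: "0 \<le> L\<^sub>1" "mismatch M M' w \<pi>' \<pi>' V = ennreal L\<^sub>1"
    "\<And>x. x \<in> state_set M \<Longrightarrow> \<bar>P'.bellman_real u x - Q'.bellman_real u x\<bar> \<le> L\<^sub>1 * w x"
    using mismatches(1)[OF u] by auto
  obtain L\<^sub>2 where L\<^sub>2: "0 \<le> L\<^sub>2" "mismatch M M' w \<pi> \<pi>' V = ennreal L\<^sub>2"
    "\<And>x. x \<in> state_set M \<Longrightarrow> \<bar>u x - Q'.bellman_real u x\<bar> \<le> L\<^sub>2 * w x"
    using mismatches(2)[OF u] fixed(1) by auto

  have dist': "\<bar>P'.value_real x - u' x\<bar> \<le> K\<^sub>1 * w x / (1 - q)" if "x \<in> state_set M" for x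
    using P'.value_real_dist[OF that u'(1) K\<^sub>1(1,3)] by (simp add: disc q_def)

  \<comment> \<open>Bounds anchored at V': the triangle inequality through u', whose distance to the value of the policy is already controlled by dist'.\<close>
  have via_V': "wnorm (state_set M) w (\<lambda>s. policy_value M \<pi>' s - V s)
      \<le> ennreal (1 / (1 - q)) * (ennreal K\<^sub>1 + ennreal K)"
    if K: "0 \<le> K" "\<And>x. x \<in> state_set M \<Longrightarrow> \<bar>u x - u' x\<bar> \<le> K * w x / (1 - q)" for K
  proof -
    have "\<bar>P'.value_real x - u x\<bar> \<le> 1 / (1 - q) * (K\<^sub>1 + K) * w x" if x: "x \<in> state_set M" for x
    proof -
      have "\<bar>P'.value_real x - u x\<bar> \<le> K\<^sub>1 * w x / (1 - q) + K * w x / (1 - q)"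
        using dist'[OF x] K(2)[OF x] by linarith
      then show ?thesis by (simp add: algebra_simps add_divide_distrib)
    qed
    then have "wnorm (state_set M) w (\<lambda>s. policy_value M \<pi>' s - V s)
        \<le> ennreal (1 / (1 - q) * (K\<^sub>1 + K))"
      using q K(1) K\<^sub>1(1) by (intro goal) auto
    also have "ennreal (1 / (1 - q) * (K\<^sub>1 + K)) = ennreal (1 / (1 - q)) * (ennreal K\<^sub>1 + ennreal K)"
      using q K(1) K\<^sub>1(1) by (subst ennreal_mult) auto
    finally show ?thesis .
  qed

  \<comment> \<open>Bounds anchored at V: the residual of u under the deployed policy in M splits into a model mismatch and the residual in the approximate model.  The factor (1 + q) / (1 - q) is what the optimal mismatch yields; one more 1 / (1 - q) comes from summing residuals.\<close>
  have via_V: "wnorm (state_set M) w (\<lambda>s. policy_value M \<pi>' s - V s)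
      \<le> ennreal (1 / (1 - q)) * ennreal L\<^sub>1 + ennreal ((1 + q) / (1 - q)\<^sup>2) * ennreal L"
    if L: "0 \<le> L"
      "\<And>x. x \<in> state_set M \<Longrightarrow> \<bar>Q'.bellman_real u x - u x\<bar> \<le> (1 + q) / (1 - q) * L * w x" for L
  proof -
    let ?K = "L\<^sub>1 + (1 + q) / (1 - q) * L"
    have K: "0 \<le> ?K" using q L(1) L\<^sub>1(1) by simp
    have "\<bar>P'.bellman_real u x - u x\<bar> \<le> ?K * w x" if x: "x \<in> state_set M" for x
    proof -
      have "\<bar>P'.bellman_real u x - u x\<bar> \<le> L\<^sub>1 * w x + (1 + q) / (1 - q) * L * w x"
        using L\<^sub>1(3)[OF x] L(2)[OF x] by linarith
      then show ?thesis by (simp only: distrib_right)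
    qed
    from P'.value_real_dist[OF _ u(1) K this]
    have "wnorm (state_set M) w (\<lambda>s. policy_value M \<pi>' s - V s) \<le> ennreal (?K / (1 - q))"
      using q K by (intro goal) (auto simp: disc q_def)
    also have "?K / (1 - q) = 1 / (1 - q) * L\<^sub>1 + (1 + q) / (1 - q)\<^sup>2 * L"
      by (simp add: add_divide_distrib[where a="L\<^sub>1"] power2_eq_square)
    finally show ?thesis
      using q L(1) L\<^sub>1(1) by (simp add: ennreal_mult[symmetric] ennreal_plus[symmetric] del: ennreal_plus)
  qed

  have "wnorm (state_set M) w (\<lambda>s. policy_value M \<pi>' s - V s)
      \<le> ennreal (1 / (1 - q)) * (mismatch M M' w \<pi>' \<pi>' V' + mismatch M M' w \<pi> \<pi>' V')"
    unfolding K\<^sub>1(2) K\<^sub>2(2)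
  proof (rule via_V'[OF K\<^sub>2(1)])
    fix x assume x: "x \<in> state_set M"
    show "\<bar>u x - u' x\<bar> \<le> K\<^sub>2 * w x / (1 - q)"
      using P.value_real_dist[OF x u'(1) K\<^sub>2(1,3)] P.value_real_eq_fixed_point[OF x u(1) fixed(1)]
      by (simp add: disc q_def)
  qed
  moreover have "wnorm (state_set M) w (\<lambda>s. policy_value M \<pi>' s - V s)
      \<le> ennreal (1 / (1 - q)) * mismatch M M' w \<pi>' \<pi>' V
        + ennreal ((1 + q) / (1 - q)\<^sup>2) * mismatch M M' w \<pi> \<pi>' V"
    unfolding L\<^sub>1(2) L\<^sub>2(2)
  proof (rule via_V[OF L\<^sub>2(1)])
    fix x assume x: "x \<in> state_set M"
    \<comment> \<open>u is its own image under the Bellman operator of the optimal policy, so the mismatch itself bounds the residual; a factor of at least 1 brings it into the required form.\<close>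
    have "1 \<le> (1 + q) / (1 - q)" using q by simp
    then have "1 * (L\<^sub>2 * w x) \<le> (1 + q) / (1 - q) * (L\<^sub>2 * w x)"
      using L\<^sub>2(1) P.w_pos[OF x] by (intro mult_right_mono) auto
    with L\<^sub>2(3)[OF x] show "\<bar>Q'.bellman_real u x - u x\<bar> \<le> (1 + q) / (1 - q) * L\<^sub>2 * w x"
      by (simp add: abs_minus_commute mult.assoc)
  qed
  moreover have "wnorm (state_set M) w (\<lambda>s. policy_value M \<pi>' s - V s)
      \<le> ennreal (1 / (1 - q)) * (mismatch M M' w \<pi>' \<pi>' V' + mismatch_opt M M' w V')"
    if \<rho>: "\<rho> \<in> greedy M V' \<inter> stable_policies M \<kappa> w" for \<rho>
  proof -
    have opt_weighted: "bellman_opt M V' \<in> weighted_value_functions M c_min w"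
      using DP(1) Vw(2) by (simp add: DP_solvable_def)
    obtain b where b: "wbounded P.S w b" "\<And>x. x \<in> state_set M \<Longrightarrow> bellman_opt M V' x = ereal (b x)"
      using weighted_value_function_real[OF opt_weighted w(2)] by auto
    have "\<exists>K\<ge>0. mismatch_opt M M' w V' = ennreal K \<and> (\<forall>x\<in>state_set M. \<bar>b x - u' x\<bar> \<le> K * w x)"
      unfolding mismatch_opt_def by (rule attained[OF wbounded_diff[OF b(1) u'(1)]]) (simp add: b(2) opt(2))
    then obtain K where K: "0 \<le> K" "mismatch_opt M M' w V' = ennreal K"
      "\<And>x. x \<in> state_set M \<Longrightarrow> \<bar>b x - u' x\<bar> \<le> K * w x" by auto
    have "stable_policy M \<rho> w \<kappa>" by (rule stable) (use \<rho> in auto)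
    from optimal_value_dist[OF P.stable_policy_axioms _ this _ V u u' b(2) K(1,3)]
    have "\<bar>u x - u' x\<bar> \<le> K * w x / (1 - q)" if "x \<in> state_set M" for x
      using that assms(17) \<rho> by (simp add: disc q_def)
    from via_V'[OF K(1) this] show ?thesis by (simp only: K\<^sub>1(2) K(2))
  qed
  moreover have "wnorm (state_set M) w (\<lambda>s. policy_value M \<pi>' s - V s)
      \<le> ennreal (1 / (1 - q)) * mismatch M M' w \<pi>' \<pi>' V
        + ennreal ((1 + q) / (1 - q)\<^sup>2) * mismatch_opt M M' w V"
    if \<rho>: "\<rho> \<in> greedy M' V \<inter> stable_policies M' \<kappa> w" for \<rho>
  proof -
    have opt_weighted: "bellman_opt M' V \<in> weighted_value_functions M c_min w"
      using DP(2) Vw(1) weighted by (simp add: DP_solvable_def)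
    obtain b where b: "wbounded P.S w b" "\<And>x. x \<in> state_set M \<Longrightarrow> bellman_opt M' V x = ereal (b x)"
      using weighted_value_function_real[OF opt_weighted w(2)] by auto
    have "\<exists>K\<ge>0. mismatch_opt M M' w V = ennreal K \<and> (\<forall>x\<in>state_set M. \<bar>u x - b x\<bar> \<le> K * w x)"
      unfolding mismatch_opt_def by (rule attained[OF wbounded_diff[OF u(1) b(1)]]) (simp add: b(2) opt(1))
    then obtain K where K: "0 \<le> K" "mismatch_opt M M' w V = ennreal K"
      "\<And>x. x \<in> state_set M \<Longrightarrow> \<bar>u x - b x\<bar> \<le> K * w x" by auto
    have "stable_policy M' \<rho> w \<kappa>" by (rule stable) (use \<rho> in auto)
    \<comment> \<open>The roles of the models are exchanged: V is an approximate solution of the optimality equation of the second model, whose optimal value is V'.\<close>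
    note bound = optimal_value_dist[OF Q'.stable_policy_axioms _ this _ V',
        where v=V and u=u' and z=u and b=b and K=K]
    have dist: "\<bar>u' x - u x\<bar> \<le> K / (1 - q) * w x" if x: "x \<in> state_set M" for x
    proof -
      have "\<bar>u' x - u x\<bar> \<le> K * w x / (1 - discount M' * \<kappa>)"
      proof (rule bound)
        show "\<pi>' \<in> greedy M' V'" "\<rho> \<in> greedy M' V" using assms(18) \<rho> by auto
        show "wbounded Q'.S w u'" "wbounded Q'.S w u" using u(1) u'(1) by (simp_all add: SS)
        show "\<bar>b y - u y\<bar> \<le> K * w y" if "y \<in> state_set M'" for y
          using K(3)[of y] that by (simp add: sets_eq abs_minus_commute)
      qed (use u(2) u'(2) b(2) K(1) x in \<open>simp_all add: sets_eq\<close>)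
      then show ?thesis by (simp add: disc q_def)
    qed
    have "\<bar>Q'.bellman_real u x - u x\<bar> \<le> (1 + q) / (1 - q) * K * w x" if x: "x \<in> state_set M" for x
    proof -
      \<comment> \<open>Pass through the fixed point u': contraction gives the summand q and the distance between u and u' the summand 1 of the factor 1 + q.\<close>
      have "\<bar>Q'.bellman_real u x - Q'.bellman_real u' x\<bar> \<le> discount M' * \<kappa> * (K / (1 - q)) * w x"
      proof (rule Q'.bellman_real_contraction)
        show "\<bar>u y - u' y\<bar> \<le> K / (1 - q) * w y" if "y \<in> state_set M'" for y
          using dist[of y] that by (simp add: sets_eq abs_minus_commute)
      qed (use q K(1) u(1) u'(1) x in \<open>simp_all add: SS sets_eq\<close>)
      then have "\<bar>Q'.bellman_real u x - u' x\<bar> \<le> q * (K / (1 - q)) * w x"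
        by (simp add: fixed(2)[OF x] disc q_def)
      with dist[OF x] have "\<bar>Q'.bellman_real u x - u x\<bar> \<le> q * (K / (1 - q)) * w x + K / (1 - q) * w x"
        by linarith
      also have "\<dots> = (1 + q) / (1 - q) * K * w x" by (simp add: algebra_simps add_divide_distrib)
      finally show ?thesis .
    qed
    from via_V[OF K(1) this] show ?thesis by (simp only: L\<^sub>1(2) K(2))
  qed
  ultimately show ?thesis unfolding q_def[symmetric] by blast
qed

end
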